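(* For every integer $n \geq 2$, the discrete quantum group $\hat{\mathrm{U}}_n^+$ does not satisfy Poincaré duality, i.e. there is no family of isomorphisms $$H_p(\hat{\mathrm{U}}_n^+, M) \cong H^{3-p}(\hat{\mathrm{U}}_n^+, M), \qquad p \in \mathbb{Z},$$ natural in the $\mathrm{Pol}(\mathrm{U}_n^+)$-module $M$.
   Context: **Free unitary quantum group.** $\mathrm{U}_n^+$ is the compact quantum group whose Hopf $*$-algebra of polynomial functions is the universal unital $*$-algebra $$\mathrm{Pol}(\mathrm{U}_n^+) = \langle u_{ij},\ 1 \leq i,j \leq n \mid u u^* = u^* u = 1 = \bar u \bar u^* = \bar u^* \bar u\rangle,$$ where $u = (u_{ij})_{ij}$ and $\bar u = (u_{ij}^* )_{ij}$, with comultiplication $u_{ij} \mapsto \sum_k u_{ik} \otimes u_{kj}$ and counit $\varepsilon(u_{ij}) = \delta_{ij}$. Its discrete dual is denoted $\hat{\mathrm{U}}_n^+$. **(Co)homology.** Write $A = \mathrm{Pol}(\mathrm{U}_n^+)$. For a right $A$-module $M$, $H_p(\hat{\mathrm{U}}_n^+, M) = \mathrm{Tor}_p^{A}(M, \mathbb{C})$ and $H^p(\hat{\mathrm{U}}_n^+, M) = \mathrm{Ext}^p_{A}(\mathbb{C}, M)$ (Ext taken in right $A$-modules), where $\mathbb{C}$ carries the (left, respectively right) $A$-module structure given by the counit; these groups are zero for $p<0$. Naturality means that for each $p$ the isomorphisms form a natural isomorphism of functors from $A$-modules to complex vector spaces. *)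

theory Defs
  imports Complex_Main "HOL-Algebra.Module" "HOL-Algebra.QuotRing"
begin

section \<open>Modules over a noncommutative ring\<close>

text \<open>
  The \<^locale>\<open>module\<close> locale of the library requires a commutative ring of scalars. The record type
  is reused here, for complex vector spaces, for complex algebras (where it carries a
  multiplication as well) and for modules over such an algebra.
\<close>

definition complex_ring :: "complex ring" where
  "complex_ring = \<lparr>carrier = UNIV, mult = (*), one = 1, zero = 0, add = (+)\<rparr>"

definition opposite :: "('a, 'c) ring_scheme \<Rightarrow> ('a, 'c) ring_scheme" where
  "opposite R = R\<lparr>mult := (\<lambda>a b. b \<otimes>\<^bsub>R\<^esub> a)\<rparr>"

locale left_module = R?: ring R + M?: abelian_group M for R (structure) and M (structure) +
  assumes smult_closed:
      "\<lbrakk>a \<in> carrier R; x \<in> carrier M\<rbrakk> \<Longrightarrow> a \<odot>\<^bsub>M\<^esub> x \<in> carrier M"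
    and smult_l_distr:
      "\<lbrakk>a \<in> carrier R; b \<in> carrier R; x \<in> carrier M\<rbrakk> \<Longrightarrow>
        (a \<oplus>\<^bsub>R\<^esub> b) \<odot>\<^bsub>M\<^esub> x = a \<odot>\<^bsub>M\<^esub> x \<oplus>\<^bsub>M\<^esub> b \<odot>\<^bsub>M\<^esub> x"
    and smult_r_distr:
      "\<lbrakk>a \<in> carrier R; x \<in> carrier M; y \<in> carrier M\<rbrakk> \<Longrightarrow>
        a \<odot>\<^bsub>M\<^esub> (x \<oplus>\<^bsub>M\<^esub> y) = a \<odot>\<^bsub>M\<^esub> x \<oplus>\<^bsub>M\<^esub> a \<odot>\<^bsub>M\<^esub> y"
    and smult_assoc:
      "\<lbrakk>a \<in> carrier R; b \<in> carrier R; x \<in> carrier M\<rbrakk> \<Longrightarrow>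
        (a \<otimes>\<^bsub>R\<^esub> b) \<odot>\<^bsub>M\<^esub> x = a \<odot>\<^bsub>M\<^esub> (b \<odot>\<^bsub>M\<^esub> x)"
    and smult_one:
      "x \<in> carrier M \<Longrightarrow> \<one>\<^bsub>R\<^esub> \<odot>\<^bsub>M\<^esub> x = x"

text \<open>
  For a right module, \<open>a \<odot>\<^bsub>M\<^esub> x\<close> stands for \<open>x \<cdot> a\<close>.
\<close>

abbreviation right_module :: "('a, 'c) ring_scheme \<Rightarrow> ('a, 'm, 'd) module_scheme \<Rightarrow> bool" where
  "right_module R M \<equiv> left_module (opposite R) M"

definition mod_hom ::
  "('a, 'c) ring_scheme \<Rightarrow> ('a, 'm, 'd) module_scheme \<Rightarrow> ('a, 'n, 'e) module_scheme \<Rightarrow> ('m \<Rightarrow> 'n) set"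
where
  "mod_hom R M N = {f \<in> carrier M \<rightarrow> carrier N.
     (\<forall>x\<in>carrier M. \<forall>y\<in>carrier M. f (x \<oplus>\<^bsub>M\<^esub> y) = f x \<oplus>\<^bsub>N\<^esub> f y) \<and>
     (\<forall>a\<in>carrier R. \<forall>x\<in>carrier M. f (a \<odot>\<^bsub>M\<^esub> x) = a \<odot>\<^bsub>N\<^esub> f x)}"

definition mod_iso ::
  "('a, 'c) ring_scheme \<Rightarrow> ('a, 'm, 'd) module_scheme \<Rightarrow> ('a, 'n, 'e) module_scheme \<Rightarrow> ('m \<Rightarrow> 'n) set"
where
  "mod_iso R M N = {f \<in> mod_hom R M N. bij_betw f (carrier M) (carrier N)}"

text \<open>
  The ring operations of \<^term>\<open>M Quot N\<close> are those of the library; its multiplication and unit are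
  meaningful only when \<open>M\<close> is an algebra and \<open>N\<close> a two-sided ideal.
\<close>

definition quot_module :: "('a, 'm) module \<Rightarrow> 'm set \<Rightarrow> ('a, 'm set) module" where
  "quot_module M N =
     ring.extend (M Quot N) (module.fields (\<lambda>a X. \<Union>x\<in>X. N +>\<^bsub>M\<^esub> (a \<odot>\<^bsub>M\<^esub> x)))"

text \<open>
  The map into the quotient of \<open>M\<close> by \<open>N\<close> that a map \<open>h\<close> into \<open>M\<close> induces on cosets.
\<close>

definition induced :: "('a, 'm) module \<Rightarrow> 'm set \<Rightarrow> ('l \<Rightarrow> 'm) \<Rightarrow> 'l set \<Rightarrow> 'm set" where
  "induced M N h X = (\<Union>x\<in>X. N +>\<^bsub>M\<^esub> h x)"

definition mod_span :: "('a, 'c) ring_scheme \<Rightarrow> ('a, 'm) module \<Rightarrow> 'm set \<Rightarrow> 'm set" where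
  "mod_span R M S = \<Inter>{N. submodule N R M \<and> S \<subseteq> N}"

definition free_module :: "('a, 'c) ring_scheme \<Rightarrow> 's set \<Rightarrow> ('a, 's \<Rightarrow> 'a) module" where
  "free_module R S =
     \<lparr>carrier = {v. (\<forall>s\<in>S. v s \<in> carrier R) \<and> (\<forall>s. s \<notin> S \<longrightarrow> v s = \<zero>\<^bsub>R\<^esub>) \<and>
                     finite {s. v s \<noteq> \<zero>\<^bsub>R\<^esub>}},
      mult = undefined, one = undefined,
      zero = (\<lambda>s. \<zero>\<^bsub>R\<^esub>), add = (\<lambda>v w s. v s \<oplus>\<^bsub>R\<^esub> w s),
      smult = (\<lambda>a v s. a \<otimes>\<^bsub>R\<^esub> v s)\<rparr>"

text \<open>
  Direct summand of a free module. The lifting property cannot be stated directly, as it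
  quantifies over modules of every type. Restricting the index set \<open>S\<close> to the type of elements
  of \<open>P\<close> loses nothing, because \<open>P\<close> is a quotient of the free module on \<open>carrier P\<close>.
\<close>

definition projective :: "('a, 'c) ring_scheme \<Rightarrow> ('a, 'p) module \<Rightarrow> bool" where
  "projective R P \<longleftrightarrow> left_module R P \<and>
     (\<exists>(S :: 'p set) i r. i \<in> mod_hom R P (free_module R S) \<and> r \<in> mod_hom R (free_module R S) P \<and>
        (\<forall>x\<in>carrier P. r (i x) = x))"

text \<open>
  Complexes are indexed by the integers, with \<open>d k\<close> mapping \<open>P k\<close> to \<open>P (k - 1)\<close>; the
  augmentation is \<open>e\<close>.
\<close>

definition projective_resolution ::
  "('a, 'c) ring_scheme \<Rightarrow> ('a, 'n) module \<Rightarrow>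
   (int \<Rightarrow> ('a, 'p) module) \<Rightarrow> (int \<Rightarrow> 'p \<Rightarrow> 'p) \<Rightarrow> ('p \<Rightarrow> 'n) \<Rightarrow> bool"
where
  "projective_resolution R N P d e \<longleftrightarrow>
     left_module R N \<and>
     (\<forall>k. projective R (P k)) \<and>
     (\<forall>k<0. carrier (P k) = {\<zero>\<^bsub>P k\<^esub>}) \<and>
     (\<forall>k. d k \<in> mod_hom R (P k) (P (k - 1))) \<and>
     e \<in> mod_hom R (P 0) N \<and>
     e ` carrier (P 0) = carrier N \<and>
     {x \<in> carrier (P 0). e x = \<zero>\<^bsub>N\<^esub>} = d 1 ` carrier (P 1) \<and>
     (\<forall>k\<ge>1. {x \<in> carrier (P k). d k x = \<zero>\<^bsub>P (k - 1)\<^esub>} = d (k + 1) ` carrier (P (k + 1)))"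

definition homology_at ::
  "('a, 'u) module \<Rightarrow> ('u \<Rightarrow> 'v) \<Rightarrow> ('a, 'v) module \<Rightarrow> ('v \<Rightarrow> 'w) \<Rightarrow> ('a, 'w) module \<Rightarrow>
   ('a, 'v set) module"
where
  "homology_at U f V g W =
     quot_module (V\<lparr>carrier := {x \<in> carrier V. g x = \<zero>\<^bsub>W\<^esub>}\<rparr>) (f ` carrier U)"


section \<open>Tor and Ext over a complex algebra\<close>

text \<open>
  A complex algebra is a record \<open>A :: (complex, 'a) module\<close>. A module over it is a module over the
  underlying ring, with complex scalars acting through the multiples of the unit of \<open>A\<close>.
\<close>

definition scal :: "(complex, 'a) module \<Rightarrow> complex \<Rightarrow> 'a" where
  "scal A c = c \<odot>\<^bsub>A\<^esub> \<one>\<^bsub>A\<^esub>"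

definition single :: "'s \<Rightarrow> 's \<Rightarrow> complex" where
  "single s = (\<lambda>t. if t = s then 1 else 0)"

text \<open>
  The linear map between free vector spaces with \<open>single s \<mapsto> single (h s)\<close>.
\<close>

definition push :: "('s \<Rightarrow> 't) \<Rightarrow> ('s \<Rightarrow> complex) \<Rightarrow> 't \<Rightarrow> complex" where
  "push h v = (\<lambda>t. \<Sum>s | v s \<noteq> 0 \<and> h s = t. v s)"

abbreviation free_prod ::
  "('a, 'm) module \<Rightarrow> ('a, 'p) module \<Rightarrow> (complex, 'm \<times> 'p \<Rightarrow> complex) module" where
  "free_prod M P \<equiv> free_module complex_ring (carrier M \<times> carrier P)"

definition tensor_rels ::
  "(complex, 'a) module \<Rightarrow> ('a, 'm) module \<Rightarrow> ('a, 'p) module \<Rightarrow> ('m \<times> 'p \<Rightarrow> complex) set"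
where
  "tensor_rels A M P = mod_span complex_ring (free_prod M P)
     ({single (x \<oplus>\<^bsub>M\<^esub> x', y) \<ominus>\<^bsub>free_prod M P\<^esub> (single (x, y) \<oplus>\<^bsub>free_prod M P\<^esub> single (x', y)) | x x' y.
         x \<in> carrier M \<and> x' \<in> carrier M \<and> y \<in> carrier P} \<union>
      {single (x, y \<oplus>\<^bsub>P\<^esub> y') \<ominus>\<^bsub>free_prod M P\<^esub> (single (x, y) \<oplus>\<^bsub>free_prod M P\<^esub> single (x, y')) | x y y'.
         x \<in> carrier M \<and> y \<in> carrier P \<and> y' \<in> carrier P} \<union>
      {single (a \<odot>\<^bsub>M\<^esub> x, y) \<ominus>\<^bsub>free_prod M P\<^esub> single (x, a \<odot>\<^bsub>P\<^esub> y) | a x y.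
         a \<in> carrier A \<and> x \<in> carrier M \<and> y \<in> carrier P} \<union>
      {single (scal A c \<odot>\<^bsub>M\<^esub> x, y) \<ominus>\<^bsub>free_prod M P\<^esub> (c \<odot>\<^bsub>free_prod M P\<^esub> single (x, y)) | c x y.
         x \<in> carrier M \<and> y \<in> carrier P})"

text \<open>
  The complex vector space \<open>M \<otimes>\<^sub>A P\<close>, for a right module \<open>M\<close> and a left module \<open>P\<close>.
\<close>

definition tensor ::
  "(complex, 'a) module \<Rightarrow> ('a, 'm) module \<Rightarrow> ('a, 'p) module \<Rightarrow>
   (complex, ('m \<times> 'p \<Rightarrow> complex) set) module"
where
  "tensor A M P = quot_module (free_prod M P) (tensor_rels A M P)"

text \<open>
  The map \<open>f \<otimes> g\<close> into \<open>M \<otimes>\<^sub>A P\<close>.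
\<close>

definition tensor_map ::
  "(complex, 'a) module \<Rightarrow> ('a, 'm) module \<Rightarrow> ('a, 'p) module \<Rightarrow> ('l \<Rightarrow> 'm) \<Rightarrow> ('q \<Rightarrow> 'p) \<Rightarrow>
   ('l \<times> 'q \<Rightarrow> complex) set \<Rightarrow> ('m \<times> 'p \<Rightarrow> complex) set"
where
  "tensor_map A M P f g = induced (free_prod M P) (tensor_rels A M P) (push (map_prod f g))"

text \<open>
  Tor is computed from a projective resolution \<open>(P, d)\<close> of the left module in the second
  argument, and Ext from a projective resolution \<open>(Q, d)\<close> of the right module in the first one.
  As \<open>P k\<close> and \<open>Q k\<close> vanish for \<open>k < 0\<close>, so do Tor and Ext in negative degrees.
\<close>

definition Tor ::
  "(complex, 'a) module \<Rightarrow> (int \<Rightarrow> ('a, 'p) module) \<Rightarrow> (int \<Rightarrow> 'p \<Rightarrow> 'p) \<Rightarrow>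
   int \<Rightarrow> ('a, 'm) module \<Rightarrow> (complex, ('m \<times> 'p \<Rightarrow> complex) set set) module"
where
  "Tor A P d k M =
     homology_at (tensor A M (P (k + 1))) (tensor_map A M (P k) id (d (k + 1)))
       (tensor A M (P k)) (tensor_map A M (P (k - 1)) id (d k)) (tensor A M (P (k - 1)))"

text \<open>
  The map on \<^const>\<open>Tor\<close> induced by a morphism \<open>f\<close> with target \<open>N\<close>.
\<close>

definition Tor_map ::
  "(complex, 'a) module \<Rightarrow> (int \<Rightarrow> ('a, 'p) module) \<Rightarrow> (int \<Rightarrow> 'p \<Rightarrow> 'p) \<Rightarrow>
   int \<Rightarrow> ('a, 'n) module \<Rightarrow> ('m \<Rightarrow> 'n) \<Rightarrow>
   ('m \<times> 'p \<Rightarrow> complex) set set \<Rightarrow> ('n \<times> 'p \<Rightarrow> complex) set set"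
where
  "Tor_map A P d k N f =
     induced (tensor A N (P k))
       (tensor_map A N (P k) id (d (k + 1)) ` carrier (tensor A N (P (k + 1))))
       (tensor_map A N (P k) f id)"

text \<open>
  The complex vector space of morphisms between two right modules.
\<close>

definition hom_space ::
  "(complex, 'a) module \<Rightarrow> ('a, 'q) module \<Rightarrow> ('a, 'm) module \<Rightarrow> (complex, 'q \<Rightarrow> 'm) module"
where
  "hom_space A Q M =
     \<lparr>carrier = mod_hom (opposite A) Q M \<inter> extensional (carrier Q),
      mult = undefined, one = undefined,
      zero = (\<lambda>x\<in>carrier Q. \<zero>\<^bsub>M\<^esub>),
      add = (\<lambda>f g. \<lambda>x\<in>carrier Q. f x \<oplus>\<^bsub>M\<^esub> g x),
      smult = (\<lambda>c f. \<lambda>x\<in>carrier Q. scal A c \<odot>\<^bsub>M\<^esub> f x)\<rparr>"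

definition precomp :: "('a, 'q) module \<Rightarrow> ('q \<Rightarrow> 'r) \<Rightarrow> ('r \<Rightarrow> 'm) \<Rightarrow> 'q \<Rightarrow> 'm" where
  "precomp Q g f = (\<lambda>x\<in>carrier Q. f (g x))"

definition Ext ::
  "(complex, 'a) module \<Rightarrow> (int \<Rightarrow> ('a, 'q) module) \<Rightarrow> (int \<Rightarrow> 'q \<Rightarrow> 'q) \<Rightarrow>
   int \<Rightarrow> ('a, 'm) module \<Rightarrow> (complex, ('q \<Rightarrow> 'm) set) module"
where
  "Ext A Q d k M =
     homology_at (hom_space A (Q (k - 1)) M) (precomp (Q k) (d k))
       (hom_space A (Q k) M) (precomp (Q (k + 1)) (d (k + 1))) (hom_space A (Q (k + 1)) M)"

definition Ext_map ::
  "(complex, 'a) module \<Rightarrow> (int \<Rightarrow> ('a, 'q) module) \<Rightarrow> (int \<Rightarrow> 'q \<Rightarrow> 'q) \<Rightarrow>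
   int \<Rightarrow> ('a, 'n) module \<Rightarrow> ('m \<Rightarrow> 'n) \<Rightarrow> ('q \<Rightarrow> 'm) set \<Rightarrow> ('q \<Rightarrow> 'n) set"
where
  "Ext_map A Q d k N h =
     induced (hom_space A (Q k) N) (precomp (Q k) (d k) ` carrier (hom_space A (Q (k - 1)) N))
       (\<lambda>f. \<lambda>x\<in>carrier (Q k). h (f x))"

text \<open>
  \<open>\<phi>\<close> is a family of isomorphisms of degree \<open>k\<close> homology with degree \<open>3 - k\<close> cohomology, natural
  in the right \<open>A\<close>-module. The modules range over those whose elements belong to the type \<open>'m\<close>;
  if \<open>'m\<close> is at least as large as the underlying set of \<open>A\<close>, then every finitely generated
  module has a copy among them.
\<close>

definition poincare_duality_3 ::
  "(complex, 'a) module \<Rightarrow>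
   (int \<Rightarrow> ('a, 'p) module) \<Rightarrow> (int \<Rightarrow> 'p \<Rightarrow> 'p) \<Rightarrow>
   (int \<Rightarrow> ('a, 'q) module) \<Rightarrow> (int \<Rightarrow> 'q \<Rightarrow> 'q) \<Rightarrow>
   (int \<Rightarrow> ('a, 'm) module \<Rightarrow> ('m \<times> 'p \<Rightarrow> complex) set set \<Rightarrow> ('q \<Rightarrow> 'm) set) \<Rightarrow> bool"
where
  "poincare_duality_3 A P dP Q dQ \<phi> \<longleftrightarrow>
     (\<forall>k M. right_module A M \<longrightarrow>
        \<phi> k M \<in> mod_iso complex_ring (Tor A P dP k M) (Ext A Q dQ (3 - k) M)) \<and>
     (\<forall>k M N. \<forall>f\<in>mod_hom (opposite A) M N. right_module A M \<longrightarrow> right_module A N \<longrightarrow>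
        (\<forall>X\<in>carrier (Tor A P dP k M).
           \<phi> k N (Tor_map A P dP k N f X) = Ext_map A Q dQ (3 - k) N f (\<phi> k M X)))"


section \<open>The free unitary quantum group\<close>

text \<open>
  \<open>Gen i j\<close> stands for \<open>u\<^sub>i\<^sub>j\<close> and \<open>GenStar i j\<close> for its adjoint. The free unital *-algebra on the
  \<open>u\<^sub>i\<^sub>j\<close> has the words in these letters as a basis.
\<close>

datatype letter = Gen nat nat | GenStar nat nat

fun letter_star :: "letter \<Rightarrow> letter" where
  "letter_star (Gen i j) = GenStar i j"
| "letter_star (GenStar i j) = Gen i j"

type_synonym free_elem = "letter list \<Rightarrow> complex"

definition letters :: "nat \<Rightarrow> letter set" where
  "letters n = {Gen i j | i j. i \<in> {1..n} \<and> j \<in> {1..n}} \<union>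
               {GenStar i j | i j. i \<in> {1..n} \<and> j \<in> {1..n}}"

definition free_star_algebra :: "nat \<Rightarrow> (complex, free_elem) module" where
  "free_star_algebra n = (free_module complex_ring (lists (letters n)))
     \<lparr>mult := (\<lambda>v w s. \<Sum>k\<le>length s. v (take k s) * w (drop k s)), one := single []\<rparr>"

definition free_star :: "free_elem \<Rightarrow> free_elem" where
  "free_star v = (\<lambda>s. cnj (v (map letter_star (rev s))))"

type_synonym free_matrix = "nat \<Rightarrow> nat \<Rightarrow> free_elem"

definition gen_mat :: free_matrix where
  "gen_mat i j = single [Gen i j]"

definition mat_conj :: "free_matrix \<Rightarrow> free_matrix" where
  "mat_conj X i j = free_star (X i j)"

definition mat_adj :: "free_matrix \<Rightarrow> free_matrix" where
  "mat_adj X i j = free_star (X j i)"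

definition mat_prod :: "nat \<Rightarrow> free_matrix \<Rightarrow> free_matrix \<Rightarrow> free_matrix" where
  "mat_prod n X Y i j =
     (\<Oplus>\<^bsub>free_star_algebra n\<^esub>k\<in>{1..n}. X i k \<otimes>\<^bsub>free_star_algebra n\<^esub> Y k j)"

definition mat_one :: "nat \<Rightarrow> free_matrix" where
  "mat_one n i j = (if i = j then \<one>\<^bsub>free_star_algebra n\<^esub> else \<zero>\<^bsub>free_star_algebra n\<^esub>)"

definition unitary_rels :: "nat \<Rightarrow> free_elem set" where
  "unitary_rels n =
     (let u = gen_mat; v = mat_conj gen_mat in
      {X i j \<ominus>\<^bsub>free_star_algebra n\<^esub> mat_one n i j | X i j.
         X \<in> {mat_prod n u (mat_adj u), mat_prod n (mat_adj u) u,
              mat_prod n v (mat_adj v), mat_prod n (mat_adj v) v} \<and>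
         i \<in> {1..n} \<and> j \<in> {1..n}})"

text \<open>
  Being generated by a set that is invariant under the involution, this is the *-ideal generated
  by the relations.
\<close>

definition unitary_ideal :: "nat \<Rightarrow> free_elem set" where
  "unitary_ideal n = genideal (free_star_algebra n) (unitary_rels n \<union> free_star ` unitary_rels n)"

definition Pol_U :: "nat \<Rightarrow> (complex, free_elem set) module" where
  "Pol_U n = quot_module (free_star_algebra n) (unitary_ideal n)"

fun letter_counit :: "letter \<Rightarrow> complex" where
  "letter_counit (Gen i j) = (if i = j then 1 else 0)"
| "letter_counit (GenStar i j) = (if i = j then 1 else 0)"

definition free_counit :: "free_elem \<Rightarrow> complex" where
  "free_counit v = (\<Sum>s | v s \<noteq> 0. v s * prod_list (map letter_counit s))"

definition counit :: "free_elem set \<Rightarrow> complex" where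
  "counit X = the_elem (free_counit ` X)"

text \<open>
  As the complex numbers commute, this serves both as a left and as a right module over
  \<^term>\<open>Pol_U n\<close>.
\<close>

definition counit_module :: "(free_elem set, complex) module" where
  "counit_module = ring.extend complex_ring (module.fields (\<lambda>a z. counit a * z))"

end

theory Submission
  imports Defs
begin

text \<open>
  Duality would identify \<open>Tor\<^sub>2(A, \<complex>)\<close> with \<open>Ext\<^sup>1(\<complex>, A)\<close>, where \<open>A\<close> is the polynomial algebra seen
  as a right module over itself; naturality plays no role. The first space vanishes because \<open>A\<close> is
  free. A class in the second one is a right linear map on the kernel of the counit \<open>\<epsilon>\<close>, modulo left
  multiplications by elements of \<open>A\<close>. Such a map is the restriction of any linear \<open>D : A \<rightarrow> A\<close> with
  \<open>D(xy) = D(x)y + \<epsilon>(x)D(y)\<close>, and \<open>D(u\<^sub>i\<^sub>j) = \<delta>\<^sub>i\<^sub>j\<close>, \<open>D(u\<^sub>i\<^sub>j\<^sup>*) = -u\<^sub>i\<^sub>j\<^sup>*\<close> defines one, because it sends each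
  defining relation \<open>r\<close> to \<open>0\<close> or \<open>-r\<close>. If \<open>D\<close> were left multiplication by \<open>y\<close> on the kernel, then
  \<open>1 = D(u\<^sub>1\<^sub>1 - 1) = y(u\<^sub>1\<^sub>1 - 1)\<close>, and applying \<open>\<epsilon>\<close> gives \<open>1 = 0\<close>.
\<close>

section \<open>Free modules and projective lifting\<close>

text \<open>The formula for D is forced by D(u) = 1. Write v for the adjoint matrix of u. As the
  counit sends u to the identity matrix, the product rule applied to uv = 1 gives D(u)v + D(v) = 0,
  hence D(v) = -v. The relations for the conjugate matrix give the same condition with u transposed,
  and the identity matrix satisfies both.

  The resolutions are arbitrary, so neither A nor the kernel of the counit need occur in them. The
  class therefore has to be built on \<open>Q 1\<close>: projectivity of \<open>Q 0\<close> lifts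
  the augmentation to a right linear k from \<open>Q 0\<close> to A whose composite with the counit
  is the augmentation, and D after k after \<open>d 1\<close> is the cocycle. It is tested on a
  preimage under \<open>d 1\<close> of p(u_11 - 1), where p has augmentation 1. The value k(p) is
  unknown there, but D(k(p)) only appears multiplied on the right by u_11 - 1, which the counit
  kills.\<close>

lemma complex_ring_sel [simp]:
  "carrier complex_ring = UNIV" "mult complex_ring = (*)" "one complex_ring = 1"
  "zero complex_ring = 0" "add complex_ring = (+)"
  by (simp_all add: complex_ring_def)

lemma ring_complex_ring: "ring complex_ring"
proof (intro ringI abelian_groupI monoidI)
  show "\<exists>y\<in>carrier complex_ring. y \<oplus>\<^bsub>complex_ring\<^esub> x = \<zero>\<^bsub>complex_ring\<^esub>" for x
    by (rule bexI[of _ "- x"]) auto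
qed (auto simp: algebra_simps)

lemma opposite_sel [simp]:
  "carrier (opposite R) = carrier R" "mult (opposite R) = (\<lambda>a b. b \<otimes>\<^bsub>R\<^esub> a)"
  "one (opposite R) = one R" "zero (opposite R) = zero R" "add (opposite R) = add R"
  by (simp_all add: opposite_def)

lemma free_module_sel [simp]:
  "zero (free_module R S) = (\<lambda>s. \<zero>\<^bsub>R\<^esub>)" "add (free_module R S) = (\<lambda>v w s. v s \<oplus>\<^bsub>R\<^esub> w s)"
  "smult (free_module R S) = (\<lambda>a v s. a \<otimes>\<^bsub>R\<^esub> v s)"
  by (simp_all add: free_module_def)

lemma carrier_free_module:
  "v \<in> carrier (free_module R S) \<longleftrightarrow>
    (\<forall>s\<in>S. v s \<in> carrier R) \<and> (\<forall>s. s \<notin> S \<longrightarrow> v s = \<zero>\<^bsub>R\<^esub>) \<and> finite {s. v s \<noteq> \<zero>\<^bsub>R\<^esub>}"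
  by (simp add: free_module_def)

lemma (in ring) free_module_closed:
  assumes "v \<in> carrier (free_module R S)"
  shows "v s \<in> carrier R"
  using assms by (cases "s \<in> S") (auto simp: carrier_free_module)

lemma (in ring) left_module_free_module: "left_module R (free_module R S)"
proof -
  have closed: "\<forall>s. v s \<in> carrier R" if "v \<in> carrier (free_module R S)" for v
    using free_module_closed[OF that] by simp
  show ?thesis
  proof (intro left_module.intro left_module_axioms.intro abelian_groupI ring_axioms)
    show "v \<oplus>\<^bsub>free_module R S\<^esub> w \<in> carrier (free_module R S)"
      if v: "v \<in> carrier (free_module R S)" and w: "w \<in> carrier (free_module R S)" for v w
    proof -
      have "finite ({s. v s \<noteq> \<zero>} \<union> {s. w s \<noteq> \<zero>})"
        using v w by (simp add: carrier_free_module)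
      then have "finite {s. v s \<oplus> w s \<noteq> \<zero>}"
        by (rule finite_subset[rotated]) auto
      then show ?thesis
        using v w by (auto simp: carrier_free_module)
    qed
    show "a \<odot>\<^bsub>free_module R S\<^esub> v \<in> carrier (free_module R S)"
      if a: "a \<in> carrier R" and v: "v \<in> carrier (free_module R S)" for a v
    proof -
      have "finite {s. v s \<noteq> \<zero>}"
        using v by (simp add: carrier_free_module)
      then have "finite {s. a \<otimes> v s \<noteq> \<zero>}"
        by (rule finite_subset[rotated]) (use a in auto)
      then show ?thesis
        using v a by (auto simp: carrier_free_module)
    qed
    show "\<exists>w\<in>carrier (free_module R S). w \<oplus>\<^bsub>free_module R S\<^esub> v = \<zero>\<^bsub>free_module R S\<^esub>"
      if v: "v \<in> carrier (free_module R S)" for v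
    proof -
      have "{s. \<ominus> v s \<noteq> \<zero>} = {s. v s \<noteq> \<zero>}"
        using free_module_closed[OF v] by auto
      then have "(\<lambda>s. \<ominus> v s) \<in> carrier (free_module R S)"
        using v by (auto simp: carrier_free_module)
      then show ?thesis
        using free_module_closed[OF v] by (intro bexI) (auto simp: l_neg)
    qed
    show "\<zero>\<^bsub>free_module R S\<^esub> \<in> carrier (free_module R S)"
      by (simp add: carrier_free_module)
  qed (auto simp: fun_eq_iff a_assoc l_distr r_distr m_assoc intro: a_comm dest!: closed)
qed

section \<open>Homomorphisms of modules\<close>

lemma mod_hom_closed: "f \<in> mod_hom R M N \<Longrightarrow> x \<in> carrier M \<Longrightarrow> f x \<in> carrier N"
  and mod_hom_add: "f \<in> mod_hom R M N \<Longrightarrow> x \<in> carrier M \<Longrightarrow> y \<in> carrier M \<Longrightarrow>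
    f (x \<oplus>\<^bsub>M\<^esub> y) = f x \<oplus>\<^bsub>N\<^esub> f y"
  and mod_hom_smult: "f \<in> mod_hom R M N \<Longrightarrow> a \<in> carrier R \<Longrightarrow> x \<in> carrier M \<Longrightarrow>
    f (a \<odot>\<^bsub>M\<^esub> x) = a \<odot>\<^bsub>N\<^esub> f x"
  by (auto simp: mod_hom_def)

lemma mod_homI:
  assumes "\<And>x. x \<in> carrier M \<Longrightarrow> f x \<in> carrier N"
    and "\<And>x y. x \<in> carrier M \<Longrightarrow> y \<in> carrier M \<Longrightarrow> f (x \<oplus>\<^bsub>M\<^esub> y) = f x \<oplus>\<^bsub>N\<^esub> f y"
    and "\<And>a x. a \<in> carrier R \<Longrightarrow> x \<in> carrier M \<Longrightarrow> f (a \<odot>\<^bsub>M\<^esub> x) = a \<odot>\<^bsub>N\<^esub> f x"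
  shows "f \<in> mod_hom R M N"
  using assms by (auto simp: mod_hom_def)

lemma mod_hom_comp:
  "f \<in> mod_hom R L M \<Longrightarrow> g \<in> mod_hom R M N \<Longrightarrow> g \<circ> f \<in> mod_hom R L N"
  by (auto simp: mod_hom_def Pi_iff)

lemma mod_hom_zero:
  assumes "abelian_group M" "abelian_group N" "f \<in> mod_hom R M N"
  shows "f \<zero>\<^bsub>M\<^esub> = \<zero>\<^bsub>N\<^esub>"
proof -
  interpret M: abelian_group M by fact
  interpret N: abelian_group N by fact
  have "f \<zero>\<^bsub>M\<^esub> \<oplus>\<^bsub>N\<^esub> f \<zero>\<^bsub>M\<^esub> = f \<zero>\<^bsub>M\<^esub>"
    using mod_hom_add[OF assms(3), of "\<zero>\<^bsub>M\<^esub>" "\<zero>\<^bsub>M\<^esub>"] by simp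
  then show ?thesis
    using mod_hom_closed[OF assms(3)] by simp
qed

lemma mod_hom_minus:
  assumes "abelian_group M" "abelian_group N" "f \<in> mod_hom R M N"
    and "x \<in> carrier M" "y \<in> carrier M"
  shows "f (x \<ominus>\<^bsub>M\<^esub> y) = f x \<ominus>\<^bsub>N\<^esub> f y"
proof -
  interpret M: abelian_group M by fact
  interpret N: abelian_group N by fact
  note closed = mod_hom_closed[OF assms(3)]
  have "f (x \<ominus>\<^bsub>M\<^esub> y) \<oplus>\<^bsub>N\<^esub> f y = f x"
    using mod_hom_add[OF assms(3), of "x \<ominus>\<^bsub>M\<^esub> y" y] assms(4,5)
    by (simp add: M.minus_eq M.a_assoc M.l_neg)
  then have "f x \<ominus>\<^bsub>N\<^esub> f y = f (x \<ominus>\<^bsub>M\<^esub> y) \<oplus>\<^bsub>N\<^esub> f y \<ominus>\<^bsub>N\<^esub> f y"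
    by simp
  then show ?thesis
    using closed assms(4,5) by (simp add: N.minus_eq N.a_assoc N.r_neg)
qed

context left_module
begin

lemma smult_zero_left: "x \<in> carrier M \<Longrightarrow> \<zero>\<^bsub>R\<^esub> \<odot>\<^bsub>M\<^esub> x = \<zero>\<^bsub>M\<^esub>"
  using smult_l_distr[of "\<zero>\<^bsub>R\<^esub>" "\<zero>\<^bsub>R\<^esub>" x] smult_closed[of "\<zero>\<^bsub>R\<^esub>" x] by simp

lemma smult_zero_right: "a \<in> carrier R \<Longrightarrow> a \<odot>\<^bsub>M\<^esub> \<zero>\<^bsub>M\<^esub> = \<zero>\<^bsub>M\<^esub>"
  using smult_r_distr[of a "\<zero>\<^bsub>M\<^esub>" "\<zero>\<^bsub>M\<^esub>"] smult_closed[of a "\<zero>\<^bsub>M\<^esub>"] by simp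

lemma smult_minus_one: "x \<in> carrier M \<Longrightarrow> (\<ominus>\<^bsub>R\<^esub> \<one>\<^bsub>R\<^esub>) \<odot>\<^bsub>M\<^esub> x = \<ominus>\<^bsub>M\<^esub> x"
  using smult_l_distr[of "\<ominus>\<^bsub>R\<^esub> \<one>\<^bsub>R\<^esub>" "\<one>\<^bsub>R\<^esub>" x] smult_one[of x] smult_closed[of "\<ominus>\<^bsub>R\<^esub> \<one>\<^bsub>R\<^esub>" x]
  by (simp add: R.l_neg smult_zero_left M.minus_equality)

text \<open>Negation is scaling by -1, so closure under scalars supplies the inverses that
  \<open>submodule\<close> demands.\<close>

lemma submoduleI':
  assumes "H \<subseteq> carrier M" "\<zero>\<^bsub>M\<^esub> \<in> H"
    and "\<And>x y. x \<in> H \<Longrightarrow> y \<in> H \<Longrightarrow> x \<oplus>\<^bsub>M\<^esub> y \<in> H"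
    and smult: "\<And>a x. a \<in> carrier R \<Longrightarrow> x \<in> H \<Longrightarrow> a \<odot>\<^bsub>M\<^esub> x \<in> H"
  shows "submodule H R M"
proof -
  have "\<ominus>\<^bsub>M\<^esub> x \<in> H" if "x \<in> H" for x
    using smult[of "\<ominus>\<^bsub>R\<^esub> \<one>\<^bsub>R\<^esub>" x] that assms(1) by (simp add: smult_minus_one subset_iff)
  then show ?thesis
    using assms by (intro submodule.intro subgroup.intro submodule_axioms.intro)
      (simp_all flip: a_inv_def)
qed

end

section \<open>Submodules and spans\<close>

lemma submodule_add: "submodule H R M \<Longrightarrow> x \<in> H \<Longrightarrow> y \<in> H \<Longrightarrow> x \<oplus>\<^bsub>M\<^esub> y \<in> H"
  and submodule_zero: "submodule H R M \<Longrightarrow> \<zero>\<^bsub>M\<^esub> \<in> H"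
  using subgroup.m_closed[of H "add_monoid M"] subgroup.one_closed[of H "add_monoid M"] by (auto simp: submodule_def)

text \<open>Taken with \<open>K\<close> the zero submodule or the tensor relations, this reduces a
  claim about a whole span to its generators, by minimality of the span.\<close>

lemma submodule_vimage:
  assumes "left_module R M" "left_module R N" "f \<in> mod_hom R M N" "submodule K R N"
  shows "submodule {x \<in> carrier M. f x \<in> K} R M"
proof -
  interpret M: left_module R M by fact
  interpret N: left_module R N by fact
  show ?thesis
    using assms(3,4) mod_hom_zero[OF M.M.abelian_group_axioms N.M.abelian_group_axioms assms(3)]
    by (intro M.submoduleI')
      (auto simp: mod_hom_add mod_hom_smult M.smult_closed submodule_add submodule_zero
        submodule.smult_closed)
qed

lemma (in left_module) submodule_zero_set: "submodule {\<zero>\<^bsub>M\<^esub>} R M"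
  by (rule submoduleI') (auto simp: smult_zero_right)

lemma mod_span_minimal: "submodule N R M \<Longrightarrow> S \<subseteq> N \<Longrightarrow> mod_span R M S \<subseteq> N"
  by (auto simp: mod_span_def)

lemma subset_mod_span: "S \<subseteq> mod_span R M S"
  by (auto simp: mod_span_def)

lemma submodule_mod_span:
  assumes "left_module R M" "S \<subseteq> carrier M"
  shows "submodule (mod_span R M S) R M"
proof -
  interpret left_module R M by fact
  \<comment> \<open>The carrier is a member of the intersected family; the intersection of an empty
    family would be the whole type.\<close>
  have "submodule (carrier M) R M"
    by (rule submoduleI') (auto simp: smult_closed)
  then show ?thesis
    using assms
    by (intro submoduleI')
      (auto simp: mod_span_def submodule_add submodule_zero submodule.smult_closed)
qed

section \<open>Coordinate vectors and the universal property of free modules\<close>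

definition basis_vec :: "('a, 'c) ring_scheme \<Rightarrow> 's \<Rightarrow> 's \<Rightarrow> 'a" where
  "basis_vec R s = (\<lambda>t. if t = s then \<one>\<^bsub>R\<^esub> else \<zero>\<^bsub>R\<^esub>)"

lemma basis_vec_complex_ring: "basis_vec complex_ring = single"
  by (auto simp: basis_vec_def single_def fun_eq_iff)

lemma (in ring) basis_vec_closed: "s \<in> S \<Longrightarrow> basis_vec R s \<in> carrier (free_module R S)"
  by (auto simp: carrier_free_module basis_vec_def elim: finite_subset[rotated])

lemma (in ring) free_module_induct [consumes 1, case_names zero add]:
  assumes "v \<in> carrier (free_module R S)"
    and zero: "P \<zero>\<^bsub>free_module R S\<^esub>"
    and add: "\<And>a s w. a \<in> carrier R \<Longrightarrow> s \<in> S \<Longrightarrow> w \<in> carrier (free_module R S) \<Longrightarrow> P w \<Longrightarrow>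
      P (a \<odot>\<^bsub>free_module R S\<^esub> basis_vec R s \<oplus>\<^bsub>free_module R S\<^esub> w)"
  shows "P v"
proof -
  have "finite {s. v s \<noteq> \<zero>}"
    using assms(1) by (simp add: carrier_free_module)
  \<comment> \<open>The induction runs over a finite superset \<open>T\<close> of the support, so
    the index split off may have coefficient zero or even lie outside \<open>S\<close>.\<close>
  moreover have "P v" if "finite T" "v \<in> carrier (free_module R S)" "{s. v s \<noteq> \<zero>} \<subseteq> T" for v T
    using that
  proof (induction T arbitrary: v)
    case empty
    then have "v = \<zero>\<^bsub>free_module R S\<^esub>" by auto
    with zero show ?case by simp
  next
    case (insert t T)
    define w where "w = v(t := \<zero>)"
    have "finite {s. w s \<noteq> \<zero>}"
    proof (rule finite_subset)
      show "finite {s. v s \<noteq> \<zero>}"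
        using insert.prems by (simp add: carrier_free_module)
    qed (auto simp: w_def)
    then have w: "w \<in> carrier (free_module R S)"
      using insert.prems by (auto simp: carrier_free_module w_def)
    have "{s. w s \<noteq> \<zero>} \<subseteq> T"
      using insert.prems(2) by (auto simp: w_def)
    then have "P w"
      by (rule insert.IH[OF w])
    show ?case
    proof (cases "t \<in> S")
      case True
      have "v = v t \<odot>\<^bsub>free_module R S\<^esub> basis_vec R t \<oplus>\<^bsub>free_module R S\<^esub> w"
        using free_module_closed[OF insert.prems(1)]
        by (auto simp: w_def basis_vec_def fun_eq_iff)
      then show ?thesis
        using add[OF free_module_closed[OF insert.prems(1)] True w \<open>P w\<close>] by metis
    next
      case False
      then have "v = w"
        using insert.prems by (auto simp: w_def carrier_free_module fun_eq_iff)
      then show ?thesis using \<open>P w\<close> by simp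
    qed
  qed
  ultimately show ?thesis
    using assms(1) by blast
qed

definition free_lift ::
  "('a, 'c) ring_scheme \<Rightarrow> ('a, 'm, 'd) module_scheme \<Rightarrow> ('s \<Rightarrow> 'm) \<Rightarrow> ('s \<Rightarrow> 'a) \<Rightarrow> 'm"
where
  "free_lift R M \<phi> v = (\<Oplus>\<^bsub>M\<^esub>s\<in>{s. v s \<noteq> \<zero>\<^bsub>R\<^esub>}. v s \<odot>\<^bsub>M\<^esub> \<phi> s)"

context left_module
begin

text \<open>Sums and multiples can have smaller supports than their ingredients. Enlarging the index
  set makes the sums comparable term by term.\<close>

lemma free_lift_superset:
  assumes "v \<in> carrier (free_module R S)" "\<phi> \<in> S \<rightarrow> carrier M"
    and "finite T" "{s. v s \<noteq> \<zero>\<^bsub>R\<^esub>} \<subseteq> T" "T \<subseteq> S"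
  shows "free_lift R M \<phi> v = (\<Oplus>\<^bsub>M\<^esub>s\<in>T. v s \<odot>\<^bsub>M\<^esub> \<phi> s)"
  unfolding free_lift_def using assms
  by (intro M.add.finprod_mono_neutral_cong_left)
    (auto simp: Pi_iff carrier_free_module smult_zero_left subset_iff intro!: smult_closed)

lemma free_lift_mod_hom:
  assumes \<phi>: "\<phi> \<in> S \<rightarrow> carrier M"
  shows "free_lift R M \<phi> \<in> mod_hom R (free_module R S) M"
proof (rule mod_homI)
  interpret F: left_module R "free_module R S"
    by (rule R.left_module_free_module)
  have supp: "{s. v s \<noteq> \<zero>\<^bsub>R\<^esub>} \<subseteq> S" "finite {s. v s \<noteq> \<zero>\<^bsub>R\<^esub>}"
    if "v \<in> carrier (free_module R S)" for v
    using that by (auto simp: carrier_free_module)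
  note closed = R.free_module_closed[where S = S]
  have term_closed: "v s \<odot>\<^bsub>M\<^esub> \<phi> s \<in> carrier M" if "v \<in> carrier (free_module R S)" "s \<in> S" for v s
    using that \<phi> by (auto intro: smult_closed closed)
  fix v assume v: "v \<in> carrier (free_module R S)"
  show "free_lift R M \<phi> v \<in> carrier M"
    unfolding free_lift_def using supp[OF v] v by (intro M.finsum_closed) (auto intro: term_closed)
  show "free_lift R M \<phi> (a \<odot>\<^bsub>free_module R S\<^esub> v) = a \<odot>\<^bsub>M\<^esub> free_lift R M \<phi> v"
    if a: "a \<in> carrier R" for a
  proof -
    have "free_lift R M \<phi> (a \<odot>\<^bsub>free_module R S\<^esub> v) =
        (\<Oplus>\<^bsub>M\<^esub>s\<in>{s. v s \<noteq> \<zero>\<^bsub>R\<^esub>}. (a \<otimes>\<^bsub>R\<^esub> v s) \<odot>\<^bsub>M\<^esub> \<phi> s)"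
    proof -
      have "{s. (a \<odot>\<^bsub>free_module R S\<^esub> v) s \<noteq> \<zero>\<^bsub>R\<^esub>} \<subseteq> {s. v s \<noteq> \<zero>\<^bsub>R\<^esub>}"
        using a by auto
      from free_lift_superset[OF F.smult_closed[OF a v] \<phi> supp(2)[OF v] this supp(1)[OF v]]
      show ?thesis by simp
    qed
    also have "\<dots> = (\<Oplus>\<^bsub>M\<^esub>s\<in>{s. v s \<noteq> \<zero>\<^bsub>R\<^esub>}. a \<odot>\<^bsub>M\<^esub> (v s \<odot>\<^bsub>M\<^esub> \<phi> s))"
      using supp[OF v] v a \<phi>
      by (intro M.finsum_cong') (auto intro!: smult_closed smult_assoc closed)
    also have "\<dots> = a \<odot>\<^bsub>M\<^esub> (\<Oplus>\<^bsub>M\<^esub>s\<in>{s. v s \<noteq> \<zero>\<^bsub>R\<^esub>}. v s \<odot>\<^bsub>M\<^esub> \<phi> s)"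
      using supp(2,1)[OF v]
    proof (induction rule: finite_induct)
      case empty
      then show ?case using a by (simp add: smult_zero_right)
    next
      case (insert t T)
      have "(\<lambda>s. v s \<odot>\<^bsub>M\<^esub> \<phi> s) \<in> T \<rightarrow> carrier M" "(\<lambda>s. a \<odot>\<^bsub>M\<^esub> (v s \<odot>\<^bsub>M\<^esub> \<phi> s)) \<in> T \<rightarrow> carrier M"
        "v t \<odot>\<^bsub>M\<^esub> \<phi> t \<in> carrier M"
        using insert.prems v a by (auto intro!: smult_closed[OF a] term_closed)
      then show ?case
        using insert a by (simp add: smult_r_distr M.finsum_closed smult_closed)
    qed
    finally show ?thesis by (simp add: free_lift_def)
  qed
  fix w assume w: "w \<in> carrier (free_module R S)"
  let ?T = "{s. v s \<noteq> \<zero>\<^bsub>R\<^esub>} \<union> {s. w s \<noteq> \<zero>\<^bsub>R\<^esub>}"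
  have T: "finite ?T" "?T \<subseteq> S"
    using supp[OF v] supp[OF w] by auto
  have "free_lift R M \<phi> (v \<oplus>\<^bsub>free_module R S\<^esub> w) =
      (\<Oplus>\<^bsub>M\<^esub>s\<in>?T. v s \<odot>\<^bsub>M\<^esub> \<phi> s \<oplus>\<^bsub>M\<^esub> w s \<odot>\<^bsub>M\<^esub> \<phi> s)"
    unfolding free_lift_superset[OF F.M.a_closed[OF v w] \<phi> T(1) _ T(2)]
  proof (subst free_lift_superset[OF F.M.a_closed[OF v w] \<phi> T(1) _ T(2)])
    show "(\<Oplus>\<^bsub>M\<^esub>s\<in>?T. (v \<oplus>\<^bsub>free_module R S\<^esub> w) s \<odot>\<^bsub>M\<^esub> \<phi> s) =
        (\<Oplus>\<^bsub>M\<^esub>s\<in>?T. v s \<odot>\<^bsub>M\<^esub> \<phi> s \<oplus>\<^bsub>M\<^esub> w s \<odot>\<^bsub>M\<^esub> \<phi> s)"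
    proof (intro M.finsum_cong' refl)
      fix s assume "s \<in> ?T"
      then have "\<phi> s \<in> carrier M" using T(2) \<phi> by auto
      then show "(v \<oplus>\<^bsub>free_module R S\<^esub> w) s \<odot>\<^bsub>M\<^esub> \<phi> s = v s \<odot>\<^bsub>M\<^esub> \<phi> s \<oplus>\<^bsub>M\<^esub> w s \<odot>\<^bsub>M\<^esub> \<phi> s"
        by (simp add: smult_l_distr closed[OF v] closed[OF w])
    qed (use T(2) v w in \<open>auto intro!: M.a_closed term_closed\<close>)
  qed auto
  also have "\<dots> = (\<Oplus>\<^bsub>M\<^esub>s\<in>?T. v s \<odot>\<^bsub>M\<^esub> \<phi> s) \<oplus>\<^bsub>M\<^esub> (\<Oplus>\<^bsub>M\<^esub>s\<in>?T. w s \<odot>\<^bsub>M\<^esub> \<phi> s)"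
    using T(2) v w by (intro M.finsum_addf) (auto intro!: term_closed)
  also have "\<dots> = free_lift R M \<phi> v \<oplus>\<^bsub>M\<^esub> free_lift R M \<phi> w"
    using free_lift_superset[OF v \<phi> T(1) _ T(2)] free_lift_superset[OF w \<phi> T(1) _ T(2)] by simp
  finally show "free_lift R M \<phi> (v \<oplus>\<^bsub>free_module R S\<^esub> w) =
    free_lift R M \<phi> v \<oplus>\<^bsub>M\<^esub> free_lift R M \<phi> w" .
qed

lemma free_lift_basis_vec:
  assumes "\<one>\<^bsub>R\<^esub> \<noteq> \<zero>\<^bsub>R\<^esub>" "\<phi> s \<in> carrier M"
  shows "free_lift R M \<phi> (basis_vec R s) = \<phi> s"
proof -
  have "{t. basis_vec R s t \<noteq> \<zero>\<^bsub>R\<^esub>} = {s}"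
    using assms by (auto simp: basis_vec_def)
  then show ?thesis
    using assms smult_closed[of "\<one>\<^bsub>R\<^esub>" "\<phi> s"] by (simp add: free_lift_def basis_vec_def smult_one)
qed

lemma free_module_hom_eqI:
  assumes "f \<in> mod_hom R (free_module R S) M" "g \<in> mod_hom R (free_module R S) M"
    and "\<And>s. s \<in> S \<Longrightarrow> f (basis_vec R s) = g (basis_vec R s)"
    and "v \<in> carrier (free_module R S)"
  shows "f v = g v"
proof -
  interpret F: left_module R "free_module R S"
    by (rule R.left_module_free_module)
  show ?thesis
    using assms(4)
  proof (induction rule: R.free_module_induct)
    case zero
    then show ?case
      using mod_hom_zero[OF F.M.abelian_group_axioms M.abelian_group_axioms] assms(1,2) by metis
  next
    case (add a s w)
    note b = R.basis_vec_closed[OF add(2)]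
    have "f (a \<odot>\<^bsub>free_module R S\<^esub> basis_vec R s \<oplus>\<^bsub>free_module R S\<^esub> w) =
        a \<odot>\<^bsub>M\<^esub> f (basis_vec R s) \<oplus>\<^bsub>M\<^esub> f w"
      using mod_hom_add[OF assms(1) F.smult_closed[OF add(1) b] add(3)] mod_hom_smult[OF assms(1) add(1) b]
      by simp
    also have "\<dots> = a \<odot>\<^bsub>M\<^esub> g (basis_vec R s) \<oplus>\<^bsub>M\<^esub> g w"
      using assms(3) add by simp
    also have "\<dots> = g (a \<odot>\<^bsub>free_module R S\<^esub> basis_vec R s \<oplus>\<^bsub>free_module R S\<^esub> w)"
      using mod_hom_add[OF assms(2) F.smult_closed[OF add(1) b] add(3)] mod_hom_smult[OF assms(2) add(1) b]
      by simp
    finally show ?case .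
  qed
qed

end

text \<open>As \<open>projective\<close> means being a retract of a free module, the lifting
  property has to be recovered: choose preimages under \<open>p\<close> of the images of the basis
  vectors, extend linearly, and restrict along the embedding \<open>i\<close>.\<close>

lemma projective_lift:
  fixes P :: "('a, 'p) module"
  assumes "projective R P" "left_module R M" "left_module R N" "\<one>\<^bsub>R\<^esub> \<noteq> \<zero>\<^bsub>R\<^esub>"
    and p: "p \<in> mod_hom R M N" "p ` carrier M = carrier N" and f: "f \<in> mod_hom R P N"
  obtains h where "h \<in> mod_hom R P M" "\<And>x. x \<in> carrier P \<Longrightarrow> p (h x) = f x"
proof -
  interpret M: left_module R M by fact
  interpret N: left_module R N by fact
  obtain S :: "'p set" and i r where i: "i \<in> mod_hom R P (free_module R S)"
    and r: "r \<in> mod_hom R (free_module R S) P" and ri: "\<And>x. x \<in> carrier P \<Longrightarrow> r (i x) = x"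
    using assms(1) by (auto simp: projective_def)
  have "\<exists>m\<in>carrier M. p m = f (r (basis_vec R s))" if "s \<in> S" for s
    using mod_hom_closed[OF f mod_hom_closed[OF r M.R.basis_vec_closed[OF that]]] p(2)
    by (metis (no_types, lifting) imageE)
  then obtain \<phi> where \<phi>: "\<And>s. s \<in> S \<Longrightarrow> \<phi> s \<in> carrier M \<and> p (\<phi> s) = f (r (basis_vec R s))"
    by metis
  have lift: "free_lift R M \<phi> \<in> mod_hom R (free_module R S) M"
    using \<phi> by (intro M.free_lift_mod_hom) auto
  have "(p \<circ> free_lift R M \<phi>) v = (f \<circ> r) v" if "v \<in> carrier (free_module R S)" for v
    using mod_hom_comp[OF lift p(1)] mod_hom_comp[OF r f] _ that
    by (rule N.free_module_hom_eqI) (use \<phi> in \<open>simp add: M.free_lift_basis_vec assms(4)\<close>)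
  then have "p ((free_lift R M \<phi> \<circ> i) x) = f x" if "x \<in> carrier P" for x
    using that ri mod_hom_closed[OF i] by simp
  with mod_hom_comp[OF i lift] show ?thesis
    using that by blast
qed

section \<open>Cosets and tensor relations\<close>

lemma (in abelian_group) coset_eq_iff:
  assumes "subgroup H (add_monoid G)" "x \<in> carrier G" "y \<in> carrier G"
  shows "H +> x = H +> y \<longleftrightarrow> x \<ominus> y \<in> H"
proof
  have H: "H \<subseteq> carrier G" "\<zero> \<in> H"
    using subgroup.subset[OF assms(1)] subgroup.one_closed[OF assms(1)] by auto
  show "x \<ominus> y \<in> H" if "H +> x = H +> y"
  proof -
    have "x \<in> H +> y"
      using a_rcosI[OF H(2,1) assms(2)] that assms(2) by simp
    then obtain h where "h \<in> H" "x = h \<oplus> y"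
      by (auto simp: a_r_coset_def')
    then show ?thesis
      using H assms by (auto simp: minus_eq a_assoc r_neg)
  qed
  show "H +> x = H +> y" if "x \<ominus> y \<in> H"
  proof -
    have "(x \<ominus> y) \<oplus> y \<in> H +> y"
      using a_rcosI[OF that H(1) assms(3)] .
    then have "x \<in> H +> y"
      using assms by (simp add: minus_eq a_assoc l_neg)
    from a_repr_independence[OF this assms(3,1)] show ?thesis ..
  qed
qed

lemma (in abelian_group) coset_add:
  assumes "subgroup H (add_monoid G)" "x \<in> carrier G" "y \<in> carrier G"
  shows "(H +> x) <+> (H +> y) = H +> (x \<oplus> y)"
  using assms by (intro abelian_subgroup.a_rcos_sum abelian_subgroupI3 additive_subgroupI)
    (auto intro: abelian_group_axioms)

text \<open>\<open>induced\<close> takes a union over all representatives. If \<open>h\<close> maps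
  \<open>K\<close> into \<open>N\<close>, all of them give one and the same coset, and there is at
  least one representative.\<close>

lemma induced_coset:
  assumes "abelian_group L" "abelian_group M" "subgroup K (add_monoid L)" "subgroup N (add_monoid M)"
    and h: "\<And>x. x \<in> carrier L \<Longrightarrow> h x \<in> carrier M"
      "\<And>x y. x \<in> carrier L \<Longrightarrow> y \<in> carrier L \<Longrightarrow> h (x \<oplus>\<^bsub>L\<^esub> y) = h x \<oplus>\<^bsub>M\<^esub> h y"
    and KN: "h ` K \<subseteq> N" and x: "x \<in> carrier L"
  shows "induced M N h (K +>\<^bsub>L\<^esub> x) = N +>\<^bsub>M\<^esub> h x"
proof -
  interpret L: abelian_group L by fact
  interpret M: abelian_group M by fact
  have K: "K \<subseteq> carrier L" "\<zero>\<^bsub>L\<^esub> \<in> K"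
    using subgroup.subset[OF assms(3)] subgroup.one_closed[OF assms(3)] by auto
  have "N +>\<^bsub>M\<^esub> h y = N +>\<^bsub>M\<^esub> h x" if y: "y \<in> K +>\<^bsub>L\<^esub> x" for y
  proof -
    obtain k where k: "k \<in> K" "y = k \<oplus>\<^bsub>L\<^esub> x"
      using y by (auto simp: a_r_coset_def')
    then have "h y = h k \<oplus>\<^bsub>M\<^esub> h x"
      using h(2) K(1) x by auto
    then have "h y \<in> N +>\<^bsub>M\<^esub> h x"
      using k(1) KN by (auto simp: a_r_coset_def')
    from M.a_repr_independence[OF this h(1)[OF x] assms(4)] show ?thesis ..
  qed
  moreover have "K +>\<^bsub>L\<^esub> x \<noteq> {}"
    using L.a_rcosI[OF K(2,1) x] by auto
  ultimately show ?thesis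
    by (auto simp: induced_def)
qed

lemma quot_module_sel [simp]:
  "carrier (quot_module M N) = a_rcosets\<^bsub>M\<^esub> N" "zero (quot_module M N) = N"
  "add (quot_module M N) = set_add M" "one (quot_module M N) = N +>\<^bsub>M\<^esub> \<one>\<^bsub>M\<^esub>"
  "mult (quot_module M N) = rcoset_mult M N"
  "smult (quot_module M N) = (\<lambda>a X. \<Union>x\<in>X. N +>\<^bsub>M\<^esub> (a \<odot>\<^bsub>M\<^esub> x))"
  by (simp_all add: quot_module_def ring.defs module.defs FactRing_def)

lemma a_rcosets_eq: "a_rcosets\<^bsub>M\<^esub> N = (\<lambda>x. N +>\<^bsub>M\<^esub> x) ` carrier M"
  by (auto simp: A_RCOSETS_def')

text \<open>The axioms say that c goes to c times the unit by a unital ring homomorphism into the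
  centre; this is the only way in which complex scalars act on modules over
  \<open>A\<close>.\<close>

locale complex_algebra = ring A for A :: "(complex, 'a) module" (structure) +
  assumes scal_closed: "scal A c \<in> carrier A"
    and scal_add: "scal A (c + d) = scal A c \<oplus> scal A d"
    and scal_mult: "scal A (c * d) = scal A c \<otimes> scal A d"
    and scal_one: "scal A 1 = \<one>"
    and scal_commute: "x \<in> carrier A \<Longrightarrow> scal A c \<otimes> x = x \<otimes> scal A c"

definition right_regular :: "('a, 'c) ring_scheme \<Rightarrow> ('a, 'a) module" where
  "right_regular R = \<lparr>carrier = carrier R, mult = undefined, one = undefined, zero = \<zero>\<^bsub>R\<^esub>,
     add = add R, smult = (\<lambda>a x. x \<otimes>\<^bsub>R\<^esub> a)\<rparr>"

lemma right_regular_sel [simp]: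
  "carrier (right_regular R) = carrier R" "zero (right_regular R) = zero R"
  "add (right_regular R) = add R" "smult (right_regular R) = (\<lambda>a x. x \<otimes>\<^bsub>R\<^esub> a)"
  by (simp_all add: right_regular_def)

lemma (in ring) ring_opposite: "ring (opposite R)"
  by (intro ringI abelian_groupI monoidI)
    (auto simp: a_assoc m_assoc l_distr r_distr intro: a_comm bexI[of _ "\<ominus> _"] l_neg)

text \<open>Makes an \<open>A\<close>-module an admissible target for \<open>free_lift\<close> over
  \<open>complex_ring\<close>.\<close>

definition restrict_scalars ::
  "(complex, 'a) module \<Rightarrow> ('a, 'p) module \<Rightarrow> (complex, 'p) module"
where
  "restrict_scalars A P = \<lparr>carrier = carrier P, mult = undefined, one = undefined,
     zero = \<zero>\<^bsub>P\<^esub>, add = add P, smult = (\<lambda>c x. scal A c \<odot>\<^bsub>P\<^esub> x)\<rparr>"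

lemma restrict_scalars_sel [simp]:
  "carrier (restrict_scalars A P) = carrier P" "zero (restrict_scalars A P) = zero P"
  "add (restrict_scalars A P) = add P"
  "smult (restrict_scalars A P) = (\<lambda>c x. scal A c \<odot>\<^bsub>P\<^esub> x)"
  by (simp_all add: restrict_scalars_def)

lemma (in complex_algebra) left_module_restrict_scalars:
  assumes "left_module A P"
  shows "left_module complex_ring (restrict_scalars A P)"
proof -
  interpret P: left_module A P by fact
  show ?thesis
    by (intro left_module.intro left_module_axioms.intro abelian_groupI ring_complex_ring)
      (auto simp: P.M.a_assoc P.smult_closed P.smult_l_distr P.smult_r_distr P.smult_assoc
        P.smult_one scal_closed scal_add scal_mult scal_one
        intro: P.M.a_comm bexI[of _ "\<ominus>\<^bsub>P\<^esub> _"] P.M.l_neg)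
qed

interpretation complex_ring: ring complex_ring
  by (rule ring_complex_ring)

section \<open>Free complex vector spaces and the relations of the tensor product\<close>

lemma left_module_free_complex: "left_module complex_ring (free_module complex_ring S)"
  by (rule complex_ring.left_module_free_module)

lemma abelian_group_free_complex: "abelian_group (free_module complex_ring S)"
  using left_module_free_complex by (rule left_module.axioms)

lemma single_closed: "s \<in> S \<Longrightarrow> single s \<in> carrier (free_module complex_ring S)"
  using complex_ring.basis_vec_closed[of s S] by (simp add: basis_vec_complex_ring)

lemma push_eq_sum:
  assumes "finite T" "{s. v s \<noteq> 0} \<subseteq> T"
  shows "push h v t = (\<Sum>s\<in>T. if h s = t then v s else 0)"
  unfolding push_def using assms by (subst sum.If_cases) (auto intro!: sum.mono_neutral_left)

lemma push_single: "push h (single s) = single (h s)"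
proof
  show "push h (single s) t = single (h s) t" for t
    using push_eq_sum[of "{s}" "single s" h t] by (auto simp: single_def)
qed

lemma push_mod_hom:
  assumes "h \<in> S \<rightarrow> T"
  shows "push h \<in> mod_hom complex_ring (free_module complex_ring S) (free_module complex_ring T)"
proof (rule mod_homI)
  fix v assume v: "v \<in> carrier (free_module complex_ring S)"
  then have fin: "finite {s. v s \<noteq> 0}" and supp: "{s. v s \<noteq> 0} \<subseteq> S"
    by (auto simp: carrier_free_module)
  have *: "t \<in> h ` {s. v s \<noteq> 0}" if "push h v t \<noteq> 0" for t
  proof (rule ccontr)
    assume "t \<notin> h ` {s. v s \<noteq> 0}"
    then have "{s. v s \<noteq> 0 \<and> h s = t} = {}" by auto
    with that show False by (simp add: push_def)
  qed
  have "finite {t. push h v t \<noteq> 0}"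
    using * by (intro finite_subset[OF _ finite_imageI[OF fin, of h]]) auto
  then show "push h v \<in> carrier (free_module complex_ring T)"
    using * supp assms by (fastforce simp: carrier_free_module)
  show "push h (a \<odot>\<^bsub>free_module complex_ring S\<^esub> v) = a \<odot>\<^bsub>free_module complex_ring T\<^esub> push h v" for a
  proof
    have "{s. (a \<odot>\<^bsub>free_module complex_ring S\<^esub> v) s \<noteq> 0} \<subseteq> {s. v s \<noteq> 0}" by auto
    from push_eq_sum[OF fin this] push_eq_sum[OF fin order_refl, of h]
    show "push h (a \<odot>\<^bsub>free_module complex_ring S\<^esub> v) t =
        (a \<odot>\<^bsub>free_module complex_ring T\<^esub> push h v) t" for t
      by (simp add: sum_distrib_left if_distrib cong: if_cong)
  qed
  fix w assume "w \<in> carrier (free_module complex_ring S)"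
  then have "finite {s. w s \<noteq> 0}"
    by (auto simp: carrier_free_module)
  with fin have fin': "finite ({s. v s \<noteq> 0} \<union> {s. w s \<noteq> 0})" by simp
  show "push h (v \<oplus>\<^bsub>free_module complex_ring S\<^esub> w) =
      push h v \<oplus>\<^bsub>free_module complex_ring T\<^esub> push h w"
  proof
    fix t
    have "{s. (v \<oplus>\<^bsub>free_module complex_ring S\<^esub> w) s \<noteq> 0} \<subseteq> {s. v s \<noteq> 0} \<union> {s. w s \<noteq> 0}" by auto
    from push_eq_sum[OF fin' this, of h t] push_eq_sum[OF fin', of v h t] push_eq_sum[OF fin', of w h t]
    show "push h (v \<oplus>\<^bsub>free_module complex_ring S\<^esub> w) t =
        (push h v \<oplus>\<^bsub>free_module complex_ring T\<^esub> push h w) t"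
      by (auto simp: sum.distrib[symmetric] intro!: sum.cong)
  qed
qed

context complex_algebra
begin

text \<open>The interface to the span: minimality serves to define maps out of the tensor product,
  and the four kinds of generators give the identities inside it.\<close>

lemma
  assumes "right_module A M" "left_module A P"
  shows submodule_tensor_rels: "submodule (tensor_rels A M P) complex_ring (free_prod M P)"
    and tensor_rels_minimal: "\<And>K. submodule K complex_ring (free_prod M P) \<Longrightarrow>
      (\<And>x x' y. x \<in> carrier M \<Longrightarrow> x' \<in> carrier M \<Longrightarrow> y \<in> carrier P \<Longrightarrow>
        single (x \<oplus>\<^bsub>M\<^esub> x', y) \<ominus>\<^bsub>free_prod M P\<^esub>
          (single (x, y) \<oplus>\<^bsub>free_prod M P\<^esub> single (x', y)) \<in> K) \<Longrightarrow>
      (\<And>x y y'. x \<in> carrier M \<Longrightarrow> y \<in> carrier P \<Longrightarrow> y' \<in> carrier P \<Longrightarrow>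
        single (x, y \<oplus>\<^bsub>P\<^esub> y') \<ominus>\<^bsub>free_prod M P\<^esub>
          (single (x, y) \<oplus>\<^bsub>free_prod M P\<^esub> single (x, y')) \<in> K) \<Longrightarrow>
      (\<And>a x y. a \<in> carrier A \<Longrightarrow> x \<in> carrier M \<Longrightarrow> y \<in> carrier P \<Longrightarrow>
        single (a \<odot>\<^bsub>M\<^esub> x, y) \<ominus>\<^bsub>free_prod M P\<^esub> single (x, a \<odot>\<^bsub>P\<^esub> y) \<in> K) \<Longrightarrow>
      (\<And>c x y. x \<in> carrier M \<Longrightarrow> y \<in> carrier P \<Longrightarrow>
        single (scal A c \<odot>\<^bsub>M\<^esub> x, y) \<ominus>\<^bsub>free_prod M P\<^esub>
          (c \<odot>\<^bsub>free_prod M P\<^esub> single (x, y)) \<in> K) \<Longrightarrow>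
      tensor_rels A M P \<subseteq> K"
    and tensor_rels_add_left: "\<And>x x' y. x \<in> carrier M \<Longrightarrow> x' \<in> carrier M \<Longrightarrow> y \<in> carrier P \<Longrightarrow>
      single (x \<oplus>\<^bsub>M\<^esub> x', y) \<ominus>\<^bsub>free_prod M P\<^esub>
        (single (x, y) \<oplus>\<^bsub>free_prod M P\<^esub> single (x', y)) \<in> tensor_rels A M P"
    and tensor_rels_add_right: "\<And>x y y'. x \<in> carrier M \<Longrightarrow> y \<in> carrier P \<Longrightarrow> y' \<in> carrier P \<Longrightarrow>
      single (x, y \<oplus>\<^bsub>P\<^esub> y') \<ominus>\<^bsub>free_prod M P\<^esub>
        (single (x, y) \<oplus>\<^bsub>free_prod M P\<^esub> single (x, y')) \<in> tensor_rels A M P"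
    and tensor_rels_balanced: "\<And>a x y. a \<in> carrier A \<Longrightarrow> x \<in> carrier M \<Longrightarrow> y \<in> carrier P \<Longrightarrow>
      single (a \<odot>\<^bsub>M\<^esub> x, y) \<ominus>\<^bsub>free_prod M P\<^esub> single (x, a \<odot>\<^bsub>P\<^esub> y) \<in> tensor_rels A M P"
    and tensor_rels_scal: "\<And>c x y. x \<in> carrier M \<Longrightarrow> y \<in> carrier P \<Longrightarrow>
      single (scal A c \<odot>\<^bsub>M\<^esub> x, y) \<ominus>\<^bsub>free_prod M P\<^esub>
        (c \<odot>\<^bsub>free_prod M P\<^esub> single (x, y)) \<in> tensor_rels A M P"
proof -
  interpret M: left_module "opposite A" M by fact
  interpret P: left_module A P by fact
  interpret F: left_module complex_ring "free_prod M P"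
    by (rule left_module_free_complex)
  note smult_closed = M.smult_closed[simplified]
  show "submodule (tensor_rels A M P) complex_ring (free_prod M P)"
    unfolding tensor_rels_def
    by (intro submodule_mod_span left_module_free_complex)
      (auto simp del: free_module_sel intro!: F.M.minus_closed F.M.a_closed single_closed smult_closed P.smult_closed
        scal_closed F.smult_closed)
  {
    fix K
    assume K: "submodule K complex_ring (free_prod M P)"
      "\<And>x x' y. x \<in> carrier M \<Longrightarrow> x' \<in> carrier M \<Longrightarrow> y \<in> carrier P \<Longrightarrow>
        single (x \<oplus>\<^bsub>M\<^esub> x', y) \<ominus>\<^bsub>free_prod M P\<^esub>
          (single (x, y) \<oplus>\<^bsub>free_prod M P\<^esub> single (x', y)) \<in> K"
      "\<And>x y y'. x \<in> carrier M \<Longrightarrow> y \<in> carrier P \<Longrightarrow> y' \<in> carrier P \<Longrightarrow>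
        single (x, y \<oplus>\<^bsub>P\<^esub> y') \<ominus>\<^bsub>free_prod M P\<^esub>
          (single (x, y) \<oplus>\<^bsub>free_prod M P\<^esub> single (x, y')) \<in> K"
      "\<And>a x y. a \<in> carrier A \<Longrightarrow> x \<in> carrier M \<Longrightarrow> y \<in> carrier P \<Longrightarrow>
        single (a \<odot>\<^bsub>M\<^esub> x, y) \<ominus>\<^bsub>free_prod M P\<^esub> single (x, a \<odot>\<^bsub>P\<^esub> y) \<in> K"
      "\<And>c x y. x \<in> carrier M \<Longrightarrow> y \<in> carrier P \<Longrightarrow>
        single (scal A c \<odot>\<^bsub>M\<^esub> x, y) \<ominus>\<^bsub>free_prod M P\<^esub>
          (c \<odot>\<^bsub>free_prod M P\<^esub> single (x, y)) \<in> K"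
    show "tensor_rels A M P \<subseteq> K"
      unfolding tensor_rels_def using K(2-)
      by (intro mod_span_minimal K(1)) (auto simp del: free_module_sel)
  }
  note gen = subsetD[OF subset_mod_span]
  show "single (x \<oplus>\<^bsub>M\<^esub> x', y) \<ominus>\<^bsub>free_prod M P\<^esub>
      (single (x, y) \<oplus>\<^bsub>free_prod M P\<^esub> single (x', y)) \<in> tensor_rels A M P"
    if "x \<in> carrier M" "x' \<in> carrier M" "y \<in> carrier P" for x x' y
    unfolding tensor_rels_def using that by (intro gen) blast
  show "single (x, y \<oplus>\<^bsub>P\<^esub> y') \<ominus>\<^bsub>free_prod M P\<^esub>
      (single (x, y) \<oplus>\<^bsub>free_prod M P\<^esub> single (x, y')) \<in> tensor_rels A M P"
    if "x \<in> carrier M" "y \<in> carrier P" "y' \<in> carrier P" for x y y'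
    unfolding tensor_rels_def using that by (intro gen) blast
  show "single (a \<odot>\<^bsub>M\<^esub> x, y) \<ominus>\<^bsub>free_prod M P\<^esub> single (x, a \<odot>\<^bsub>P\<^esub> y) \<in> tensor_rels A M P"
    if "a \<in> carrier A" "x \<in> carrier M" "y \<in> carrier P" for a x y
    unfolding tensor_rels_def using that by (intro gen) blast
  show "single (scal A c \<odot>\<^bsub>M\<^esub> x, y) \<ominus>\<^bsub>free_prod M P\<^esub>
      (c \<odot>\<^bsub>free_prod M P\<^esub> single (x, y)) \<in> tensor_rels A M P"
    if "x \<in> carrier M" "y \<in> carrier P" for c x y
    unfolding tensor_rels_def using that by (intro gen) blast
qed

end

section \<open>Tor of a free module of rank one\<close>

text \<open>A free right module of rank one, given by a generator and its coordinate map. It is not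
  fixed to be \<open>A\<close> itself because the elements of the modules in the duality statement
  have a type of their own.\<close>

locale rank_one_module = complex_algebra A for A :: "(complex, 'a) module" (structure) +
  fixes M :: "('a, 'm) module" and e :: 'm and \<rho> :: "'m \<Rightarrow> 'a"
  assumes right_module: "right_module A M"
    and coord: "\<rho> \<in> mod_hom (opposite A) M (right_regular A)"
    and gen_closed: "e \<in> carrier M"
    and coord_gen: "\<rho> e = \<one>"
    and gen_coord: "m \<in> carrier M \<Longrightarrow> \<rho> m \<odot>\<^bsub>M\<^esub> e = m"
begin

text \<open>The isomorphism from \<open>P\<close> to the tensor product of \<open>M\<close> and
  \<open>P\<close>, sending p to the class of e \<otimes> p.\<close>

definition pure :: "('a, 'p) module \<Rightarrow> 'p \<Rightarrow> ('m \<times> 'p \<Rightarrow> complex) set" where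
  "pure P p = tensor_rels A M P +>\<^bsub>free_prod M P\<^esub> single (e, p)"

text \<open>The inverse of \<open>pure\<close>, before passing to the quotient: m \<otimes> p goes
  to \<rho>(m)p. It yields injectivity of \<open>pure\<close>.\<close>

definition contract :: "('a, 'p) module \<Rightarrow> ('m \<times> 'p \<Rightarrow> complex) \<Rightarrow> 'p" where
  "contract P = free_lift complex_ring (restrict_scalars A P) (\<lambda>(m, p). \<rho> m \<odot>\<^bsub>P\<^esub> p)"

lemma coord_closed: "m \<in> carrier M \<Longrightarrow> \<rho> m \<in> carrier A"
  using mod_hom_closed[OF coord] by simp

context
  fixes P :: "('a, 'p) module"
  assumes P: "left_module A P"
begin

interpretation M: left_module "opposite A" M by (rule right_module)
interpretation P: left_module A P by (rule P)
interpretation Pc: left_module complex_ring "restrict_scalars A P"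
  by (rule left_module_restrict_scalars[OF P])
interpretation F: left_module complex_ring "free_prod M P"
  by (rule left_module_free_complex)

lemma subgroup_tensor_rels: "subgroup (tensor_rels A M P) (add_monoid (free_prod M P))"
  using submodule_tensor_rels[OF right_module P] by (simp add: submodule_def)

lemma contract_mod_hom: "contract P \<in> mod_hom complex_ring (free_prod M P) (restrict_scalars A P)"
  unfolding contract_def
  by (rule Pc.free_lift_mod_hom) (auto intro: P.smult_closed coord_closed)

lemma contract_single:
  "m \<in> carrier M \<Longrightarrow> p \<in> carrier P \<Longrightarrow> contract P (single (m, p)) = \<rho> m \<odot>\<^bsub>P\<^esub> p"
  unfolding contract_def basis_vec_complex_ring[symmetric]
  by (subst Pc.free_lift_basis_vec) (auto intro: P.smult_closed coord_closed)

lemma contract_minus: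
  "v \<in> carrier (free_prod M P) \<Longrightarrow> w \<in> carrier (free_prod M P) \<Longrightarrow>
    contract P (v \<ominus>\<^bsub>free_prod M P\<^esub> w) = contract P v \<ominus>\<^bsub>P\<^esub> contract P w"
  using mod_hom_minus[OF F.M.abelian_group_axioms Pc.M.abelian_group_axioms contract_mod_hom]
  \<comment> \<open>Unfolded this far, subtraction depends only on carrier, addition and zero, which
    \<open>P\<close> shares with \<open>restrict_scalars A P\<close>.\<close>
  by (simp add: a_minus_def a_inv_def m_inv_def)

text \<open>The kernel of \<open>contract\<close> is a subspace containing the four kinds of
  generators: the additive ones by distributivity, the balanced one because \<rho>(xa) = \<rho>(x)a,
  and the last one because scalars are central.\<close>

lemma contract_tensor_rels: "v \<in> tensor_rels A M P \<Longrightarrow> contract P v = \<zero>\<^bsub>P\<^esub>"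
proof -
  let ?K = "{v \<in> carrier (free_prod M P). contract P v \<in> {\<zero>\<^bsub>restrict_scalars A P\<^esub>}}"
  note closed = F.M.minus_closed F.M.a_closed F.smult_closed single_closed P.smult_closed
    M.smult_closed[simplified] scal_closed coord_closed
  have add: "contract P (v \<oplus>\<^bsub>free_prod M P\<^esub> w) = contract P v \<oplus>\<^bsub>P\<^esub> contract P w"
    if "v \<in> carrier (free_prod M P)" "w \<in> carrier (free_prod M P)" for v w
    using mod_hom_add[OF contract_mod_hom that] by simp
  have smult: "contract P (c \<odot>\<^bsub>free_prod M P\<^esub> v) = scal A c \<odot>\<^bsub>P\<^esub> contract P v"
    if "v \<in> carrier (free_prod M P)" for c v
    using mod_hom_smult[OF contract_mod_hom _ that, of c] by simp
  have coord_add: "\<rho> (x \<oplus>\<^bsub>M\<^esub> y) = \<rho> x \<oplus> \<rho> y" if "x \<in> carrier M" "y \<in> carrier M" for x y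
    using mod_hom_add[OF coord that] by simp
  have coord_smult: "\<rho> (a \<odot>\<^bsub>M\<^esub> x) = \<rho> x \<otimes> a" if "x \<in> carrier M" "a \<in> carrier A" for x a
    using mod_hom_smult[OF coord, of a x] that by simp
  have self: "x \<ominus>\<^bsub>P\<^esub> x = \<zero>\<^bsub>P\<^esub>" if "x \<in> carrier P" for x
    using that by (simp add: P.M.minus_eq P.M.r_neg)
  have "submodule ?K complex_ring (free_prod M P)"
    by (intro submodule_vimage[OF left_module_free_complex Pc.left_module_axioms contract_mod_hom]
        Pc.submodule_zero_set)
  then have "tensor_rels A M P \<subseteq> ?K"
    by (rule tensor_rels_minimal[OF right_module P])
      (simp_all del: free_module_sel add: closed contract_minus contract_single add smult coord_add
        coord_smult P.smult_l_distr P.smult_r_distr P.smult_assoc scal_commute[symmetric] self)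
  then show "v \<in> tensor_rels A M P \<Longrightarrow> contract P v = \<zero>\<^bsub>P\<^esub>"
    by auto
qed

lemma pure_add: "p \<in> carrier P \<Longrightarrow> q \<in> carrier P \<Longrightarrow>
    pure P p \<oplus>\<^bsub>tensor A M P\<^esub> pure P q = pure P (p \<oplus>\<^bsub>P\<^esub> q)"
proof -
  assume p: "p \<in> carrier P" and q: "q \<in> carrier P"
  have "pure P p \<oplus>\<^bsub>tensor A M P\<^esub> pure P q =
      tensor_rels A M P +>\<^bsub>free_prod M P\<^esub> (single (e, p) \<oplus>\<^bsub>free_prod M P\<^esub> single (e, q))"
    using p q gen_closed
    by (simp del: free_module_sel add: tensor_def pure_def F.M.coset_add subgroup_tensor_rels single_closed)
  also have "\<dots> = pure P (p \<oplus>\<^bsub>P\<^esub> q)"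
    unfolding pure_def using p q gen_closed tensor_rels_add_right[OF right_module P]
    by (intro F.M.coset_eq_iff[OF subgroup_tensor_rels, THEN iffD2, symmetric])
      (simp_all del: free_module_sel add: single_closed F.M.a_closed)
  finally show ?thesis .
qed

lemma pure_inj: "p \<in> carrier P \<Longrightarrow> q \<in> carrier P \<Longrightarrow> pure P p = pure P q \<Longrightarrow> p = q"
proof -
  assume p: "p \<in> carrier P" and q: "q \<in> carrier P" and eq: "pure P p = pure P q"
  have "contract P (single (e, p) \<ominus>\<^bsub>free_prod M P\<^esub> single (e, q)) = \<zero>\<^bsub>P\<^esub>"
    using eq p q gen_closed unfolding pure_def
    by (intro contract_tensor_rels F.M.coset_eq_iff[OF subgroup_tensor_rels, THEN iffD1])
      (auto intro: single_closed)
  then show "p = q"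
    using p q gen_closed
    by (simp add: contract_minus single_closed contract_single coord_gen P.smult_one P.M.minus_eq
        P.M.add.inv_solve_right')
qed

lemma pure_zero: "pure P \<zero>\<^bsub>P\<^esub> = \<zero>\<^bsub>tensor A M P\<^esub>"
proof -
  have "single (e, \<zero>\<^bsub>P\<^esub>) \<in> tensor_rels A M P"
  proof -
    let ?x = "single (e, \<zero>\<^bsub>P\<^esub>)"
    have x: "?x \<in> carrier (free_prod M P)"
      using gen_closed by (auto intro: single_closed)
    \<comment> \<open>The relation for additivity at 0 + 0 = 0 is exactly the negative of the tensor
      that should vanish.\<close>
    have "?x \<ominus>\<^bsub>free_prod M P\<^esub> (?x \<oplus>\<^bsub>free_prod M P\<^esub> ?x) = \<ominus>\<^bsub>free_prod M P\<^esub> ?x"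
      using x by (simp del: free_module_sel add: F.M.minus_eq F.M.minus_add F.M.a_assoc[symmetric] F.M.r_neg)
    then have "\<ominus>\<^bsub>free_prod M P\<^esub> ?x \<in> tensor_rels A M P"
      using tensor_rels_add_right[OF right_module P gen_closed, of "\<zero>\<^bsub>P\<^esub>" "\<zero>\<^bsub>P\<^esub>"]
      by (simp del: free_module_sel)
    then have "\<ominus>\<^bsub>free_prod M P\<^esub> (\<ominus>\<^bsub>free_prod M P\<^esub> ?x) \<in> tensor_rels A M P"
      using subgroup.m_inv_closed[OF subgroup_tensor_rels] unfolding a_inv_def by blast
    then show ?thesis
      using x by simp
  qed
  then show ?thesis
    unfolding pure_def tensor_def quot_module_sel
    using gen_closed
    by (intro F.M.a_coset_join2 subgroup_tensor_rels) (auto intro: single_closed)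
qed

text \<open>Surjectivity of \<open>pure\<close>. With m' = mc, a term c(m \<otimes> p) equals m'
  \<otimes> p = e\<rho>(m') \<otimes> p = e \<otimes> \<rho>(m')p, and tensors with the same first
  factor e can be added.\<close>

lemma carrier_tensor: "carrier (tensor A M P) = pure P ` carrier P"
proof
  show "pure P ` carrier P \<subseteq> carrier (tensor A M P)"
    using gen_closed by (auto simp: tensor_def a_rcosets_eq pure_def intro!: imageI single_closed)
  have "\<exists>p\<in>carrier P. tensor_rels A M P +>\<^bsub>free_prod M P\<^esub> v = pure P p"
    if "v \<in> carrier (free_prod M P)" for v
    using that
  proof (induction rule: complex_ring.free_module_induct)
    case zero
    have "tensor_rels A M P +>\<^bsub>free_prod M P\<^esub> \<zero>\<^bsub>free_prod M P\<^esub> = pure P \<zero>\<^bsub>P\<^esub>"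
      unfolding pure_zero
      using subgroup.subset[OF subgroup_tensor_rels]
      by (subst F.M.a_coset_add_zero) (auto simp: tensor_def)
    then show ?case
      by (intro bexI[of _ "\<zero>\<^bsub>P\<^esub>"]) auto
  next
    case (add c s w)
    obtain m p where s: "s = (m, p)" and m: "m \<in> carrier M" and p: "p \<in> carrier P"
      using add(2) by auto
    obtain q where q: "q \<in> carrier P" and w: "tensor_rels A M P +>\<^bsub>free_prod M P\<^esub> w = pure P q"
      using add by auto
    define m' where "m' = scal A c \<odot>\<^bsub>M\<^esub> m"
    have m': "m' \<in> carrier M"
      using m M.smult_closed[of "scal A c" m] by (simp add: m'_def scal_closed)
    have cs: "c \<odot>\<^bsub>free_prod M P\<^esub> basis_vec complex_ring s \<in> carrier (free_prod M P)"
      using add(2) by (intro F.smult_closed) (auto simp: basis_vec_complex_ring intro: single_closed)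
    have "tensor_rels A M P +>\<^bsub>free_prod M P\<^esub> (c \<odot>\<^bsub>free_prod M P\<^esub> basis_vec complex_ring s) =
        tensor_rels A M P +>\<^bsub>free_prod M P\<^esub> single (m', p)"
      using tensor_rels_scal[OF right_module P m p, of c] cs m p m'
      by (intro F.M.coset_eq_iff[OF subgroup_tensor_rels, THEN iffD2, symmetric])
        (simp_all del: free_module_sel add: single_closed basis_vec_complex_ring s m'_def)
    also have "\<dots> = pure P (\<rho> m' \<odot>\<^bsub>P\<^esub> p)"
      unfolding pure_def
      using tensor_rels_balanced[OF right_module P coord_closed[OF m'] gen_closed p] m' p
      by (intro F.M.coset_eq_iff[OF subgroup_tensor_rels, THEN iffD2])
        (simp_all add: gen_coord single_closed gen_closed P.smult_closed coord_closed)
    finally have "tensor_rels A M P +>\<^bsub>free_prod M P\<^esub>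
        (c \<odot>\<^bsub>free_prod M P\<^esub> basis_vec complex_ring s \<oplus>\<^bsub>free_prod M P\<^esub> w) =
        pure P (\<rho> m' \<odot>\<^bsub>P\<^esub> p) \<oplus>\<^bsub>tensor A M P\<^esub> pure P q"
      using F.M.coset_add[OF subgroup_tensor_rels cs add(3)] by (simp add: tensor_def w)
    also have "\<dots> = pure P (\<rho> m' \<odot>\<^bsub>P\<^esub> p \<oplus>\<^bsub>P\<^esub> q)"
      using m' p q by (intro pure_add P.smult_closed coord_closed)
    finally show ?case
      using m' p q
      by (intro bexI[of _ "\<rho> m' \<odot>\<^bsub>P\<^esub> p \<oplus>\<^bsub>P\<^esub> q"]) (auto intro: P.smult_closed coord_closed)
  qed
  then show "carrier (tensor A M P) \<subseteq> pure P ` carrier P"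
    by (auto simp: tensor_def a_rcosets_eq)
qed

end

text \<open>Naturality of the isomorphism \<open>pure\<close>. Linearity of \<open>d\<close> over
  \<open>A\<close> makes the pushforward carry relations to relations, which is what
  \<open>induced_coset\<close> asks for.\<close>

lemma tensor_map_pure:
  assumes L: "left_module A L" and P: "left_module A P" and d: "d \<in> mod_hom A L P"
    and x: "x \<in> carrier L"
  shows "tensor_map A M P id d (pure L x) = pure P (d x)"
proof -
  interpret L: left_module A L by (rule L)
  interpret P: left_module A P by (rule P)
  interpret M: left_module "opposite A" M by (rule right_module)
  interpret FL: left_module complex_ring "free_prod M L"
    by (rule left_module_free_complex)
  interpret FP: left_module complex_ring "free_prod M P"
    by (rule left_module_free_complex)
  have push: "push (map_prod id d) \<in> mod_hom complex_ring (free_prod M L) (free_prod M P)"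
    using mod_hom_closed[OF d] by (intro push_mod_hom) auto
  have minus: "push (map_prod id d) (v \<ominus>\<^bsub>free_prod M L\<^esub> w) =
      push (map_prod id d) v \<ominus>\<^bsub>free_prod M P\<^esub> push (map_prod id d) w"
    if "v \<in> carrier (free_prod M L)" "w \<in> carrier (free_prod M L)" for v w
    by (rule mod_hom_minus[OF abelian_group_free_complex abelian_group_free_complex push that])
  let ?K = "{v \<in> carrier (free_prod M L). push (map_prod id d) v \<in> tensor_rels A M P}"
  have "submodule ?K complex_ring (free_prod M L)"
    by (intro submodule_vimage[OF left_module_free_complex left_module_free_complex push]
        submodule_tensor_rels right_module P)
  then have rels: "tensor_rels A M L \<subseteq> ?K"
    by (rule tensor_rels_minimal[OF right_module L])
      (simp_all del: free_module_sel add: minus mod_hom_add[OF push] mod_hom_smult[OF push] push_single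
        FL.M.minus_closed FL.M.a_closed FL.smult_closed single_closed L.smult_closed
        M.smult_closed[simplified] scal_closed mod_hom_add[OF d] mod_hom_smult[OF d] mod_hom_closed[OF d]
        tensor_rels_add_left tensor_rels_add_right tensor_rels_balanced tensor_rels_scal right_module P)
  show ?thesis
    unfolding tensor_map_def pure_def
    using x gen_closed mod_hom_closed[OF push] mod_hom_add[OF push] rels
    by (subst induced_coset[OF FL.M.abelian_group_axioms FP.M.abelian_group_axioms
          subgroup_tensor_rels[OF L] subgroup_tensor_rels[OF P]])
      (auto simp: push_single simp del: free_module_sel intro: single_closed)
qed

text \<open>Through \<open>pure\<close> the tensored complex becomes the resolution itself, which is
  exact in degrees k \<ge> 1. Having at most one element is the form of triviality that a bijection
  carries over to Ext.\<close>

lemma Tor_trivial: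
  assumes res: "projective_resolution A N P d \<epsilon>" and k: "k \<ge> 1"
    and X: "X \<in> carrier (Tor A P d k M)" and Y: "Y \<in> carrier (Tor A P d k M)"
  shows "X = Y"
proof -
  have P: "left_module A (P j)" and d: "d j \<in> mod_hom A (P j) (P (j - 1))" for j
    using res by (auto simp: projective_resolution_def projective_def)
  have exact: "{x \<in> carrier (P k). d k x = \<zero>\<^bsub>P (k - 1)\<^esub>} = d (k + 1) ` carrier (P (k + 1))"
    using res k by (simp add: projective_resolution_def)
  interpret P: left_module A "P k" by (rule P)
  interpret P0: left_module A "P (k - 1)" by (rule P)
  interpret P1: left_module A "P (k + 1)" by (rule P)
  let ?H = "tensor_map A M (P k) id (d (k + 1)) ` carrier (tensor A M (P (k + 1)))"
  have d1: "d (k + 1) \<in> mod_hom A (P (k + 1)) (P k)"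
    using d[of "k + 1"] by simp
  have H: "?H = pure (P k) ` {x \<in> carrier (P k). d k x = \<zero>\<^bsub>P (k - 1)\<^esub>}"
    by (auto simp: carrier_tensor[OF P] image_image tensor_map_pure[OF P P d1] exact
        intro!: image_cong)
  \<comment> \<open>A class is a translate of the boundaries by a cycle. Injectivity of
    \<open>pure\<close> makes this cycle come from p with d p = 0, and by exactness
    \<open>?H\<close> consists of the images of all such elements, so translation by p leaves it
    fixed.\<close>
  have const: "X = ?H" if "X \<in> carrier (Tor A P d k M)" for X
  proof -
    have "X \<in> (\<lambda>Z. \<Union>h\<in>?H. {h \<oplus>\<^bsub>tensor A M (P k)\<^esub> Z}) ` {Z \<in> carrier (tensor A M (P k)).
        tensor_map A M (P (k - 1)) id (d k) Z = \<zero>\<^bsub>tensor A M (P (k - 1))\<^esub>}"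
      using that by (simp add: Tor_def homology_at_def a_rcosets_eq a_r_coset_def')
    then obtain Z where Z: "Z \<in> carrier (tensor A M (P k))"
        "tensor_map A M (P (k - 1)) id (d k) Z = \<zero>\<^bsub>tensor A M (P (k - 1))\<^esub>"
      and X: "X = (\<lambda>h. h \<oplus>\<^bsub>tensor A M (P k)\<^esub> Z) ` ?H"
      by (auto simp del: UN_simps)
    obtain p where p: "p \<in> carrier (P k)" "Z = pure (P k) p"
      using Z(1) by (auto simp: carrier_tensor[OF P])
    have "pure (P (k - 1)) (d k p) = pure (P (k - 1)) \<zero>\<^bsub>P (k - 1)\<^esub>"
      using Z(2) p tensor_map_pure[OF P P d p(1)] by (simp add: pure_zero[OF P])
    then have p0: "d k p = \<zero>\<^bsub>P (k - 1)\<^esub>"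
      by (rule pure_inj[OF P, rotated 2]) (use mod_hom_closed[OF d p(1)] in auto)
    have "X = (\<lambda>x. pure (P k) (x \<oplus>\<^bsub>P k\<^esub> p)) ` {x \<in> carrier (P k). d k x = \<zero>\<^bsub>P (k - 1)\<^esub>}"
      unfolding X H image_image using p by (auto simp: pure_add[OF P] intro!: image_cong)
    also have "\<dots> = pure (P k) ` (\<lambda>x. x \<oplus>\<^bsub>P k\<^esub> p) ` {x \<in> carrier (P k). d k x = \<zero>\<^bsub>P (k - 1)\<^esub>}"
      by (simp add: image_image)
    also have "(\<lambda>x. x \<oplus>\<^bsub>P k\<^esub> p) ` {x \<in> carrier (P k). d k x = \<zero>\<^bsub>P (k - 1)\<^esub>} =
        {x \<in> carrier (P k). d k x = \<zero>\<^bsub>P (k - 1)\<^esub>}"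
    proof (intro equalityI subsetI)
      fix x assume x: "x \<in> {x \<in> carrier (P k). d k x = \<zero>\<^bsub>P (k - 1)\<^esub>}"
      have "d k (x \<ominus>\<^bsub>P k\<^esub> p) = \<zero>\<^bsub>P (k - 1)\<^esub>"
        using mod_hom_minus[OF P.M.abelian_group_axioms P0.M.abelian_group_axioms d, of x p] x p p0
        by (simp add: P0.M.minus_eq)
      moreover have "x = (x \<ominus>\<^bsub>P k\<^esub> p) \<oplus>\<^bsub>P k\<^esub> p"
        using x p by (simp add: P.M.minus_eq P.M.a_assoc P.M.l_neg)
      ultimately show "x \<in> (\<lambda>x. x \<oplus>\<^bsub>P k\<^esub> p) ` {x \<in> carrier (P k). d k x = \<zero>\<^bsub>P (k - 1)\<^esub>}"
        using x p by (intro image_eqI[of x _ "x \<ominus>\<^bsub>P k\<^esub> p"]) auto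
    qed (use p p0 in \<open>auto simp: mod_hom_add[OF d]\<close>)
    finally show "X = ?H"
      unfolding H .
  qed
  show ?thesis
    using const[OF X] const[OF Y] by simp
qed

end

section \<open>A nontrivial class in the first Ext group\<close>

definition character_module :: "('a \<Rightarrow> complex) \<Rightarrow> ('a, complex) module" where
  "character_module \<epsilon> = ring.extend complex_ring (module.fields (\<lambda>a z. \<epsilon> a * z))"

lemma character_module_sel [simp]:
  "carrier (character_module \<epsilon>) = UNIV" "zero (character_module \<epsilon>) = 0"
  "add (character_module \<epsilon>) = (+)" "smult (character_module \<epsilon>) = (\<lambda>a z. \<epsilon> a * z)"
  by (simp_all add: character_module_def ring.defs module.defs)

text \<open>On the kernel of \<open>\<epsilon>\<close> the product rule reads D(xy) = D(x)y, which
  is right linearity. The element \<open>b\<close> separates \<open>D\<close> from every left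
  multiplication, since \<epsilon>(yb) = \<epsilon>(y)\<epsilon>(b) = 0.\<close>

locale character_derivation = complex_algebra A for A :: "(complex, 'a) module" (structure) +
  fixes \<epsilon> :: "'a \<Rightarrow> complex" and D :: "'a \<Rightarrow> 'a" and b :: 'a
  assumes char_add: "x \<in> carrier A \<Longrightarrow> y \<in> carrier A \<Longrightarrow> \<epsilon> (x \<oplus> y) = \<epsilon> x + \<epsilon> y"
    and char_mult: "x \<in> carrier A \<Longrightarrow> y \<in> carrier A \<Longrightarrow> \<epsilon> (x \<otimes> y) = \<epsilon> x * \<epsilon> y"
    and char_scal: "\<epsilon> (scal A c) = c"
    and deriv_closed: "x \<in> carrier A \<Longrightarrow> D x \<in> carrier A"
    and deriv_add: "x \<in> carrier A \<Longrightarrow> y \<in> carrier A \<Longrightarrow> D (x \<oplus> y) = D x \<oplus> D y"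
    and deriv_mult: "x \<in> carrier A \<Longrightarrow> y \<in> carrier A \<Longrightarrow>
      D (x \<otimes> y) = D x \<otimes> y \<oplus> scal A (\<epsilon> x) \<otimes> D y"
    and b: "b \<in> carrier A" "\<epsilon> b = 0" "\<epsilon> (D b) \<noteq> 0"
begin

lemma scal_zero: "scal A 0 = \<zero>"
  using scal_add[of 0 0] scal_closed[of 0] by simp

lemma one_not_zero: "\<one> \<noteq> \<zero>"
  using char_scal[of 0] char_scal[of 1] by (auto simp: scal_zero scal_one)

lemma deriv_zero: "D \<zero> = \<zero>"
  using deriv_add[of \<zero> \<zero>] deriv_closed[of \<zero>] by simp

end

locale regular_derivation = rank_one_module A M e \<rho> + character_derivation A \<epsilon> D b
  for A :: "(complex, 'a) module" (structure) and M :: "('a, 'm) module" and e \<rho> \<epsilon> D b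
begin

text \<open>\<open>D\<close> lives on \<open>A\<close>, not on the given resolution. The composite
  of \<open>\<epsilon>\<close> and \<open>\<rho>\<close> maps \<open>M\<close> onto the trivial
  module, so projectivity of \<open>Q 0\<close> lifts the augmentation to \<open>M\<close>; in
  coordinates the lift sends the image of \<open>d 1\<close> into the kernel of
  \<open>\<epsilon>\<close>, where \<open>D\<close> is right linear.\<close>

lemma Ext_1_nontrivial:
  assumes res: "projective_resolution (opposite A) (character_module \<epsilon>) Q d \<pi>"
  obtains X Y where "X \<in> carrier (Ext A Q d 1 M)" "Y \<in> carrier (Ext A Q d 1 M)" "X \<noteq> Y"
proof -
  interpret M: left_module "opposite A" M by (rule right_module)
  have proj: "projective (opposite A) (Q j)" and Q: "left_module (opposite A) (Q j)"
    and d: "d j \<in> mod_hom (opposite A) (Q j) (Q (j - 1))" for j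
    using res by (auto simp: projective_resolution_def projective_def)
  have exact_ge: "\<And>j. 1 \<le> j \<Longrightarrow> {x \<in> carrier (Q j). d j x = \<zero>\<^bsub>Q (j - 1)\<^esub>} = d (j + 1) ` carrier (Q (j + 1))"
    and \<pi>: "\<pi> \<in> mod_hom (opposite A) (Q 0) (character_module \<epsilon>)" "\<pi> ` carrier (Q 0) = UNIV"
    "left_module (opposite A) (character_module \<epsilon>)"
    and exact0: "{x \<in> carrier (Q 0). \<pi> x = 0} = d 1 ` carrier (Q 1)"
    using res by (simp_all add: projective_resolution_def)
  have exact1: "{x \<in> carrier (Q 1). d 1 x = \<zero>\<^bsub>Q 0\<^esub>} = d 2 ` carrier (Q 2)"
    using exact_ge[of 1] by simp
  have d1: "d 1 \<in> mod_hom (opposite A) (Q 1) (Q 0)" and d2: "d 2 \<in> mod_hom (opposite A) (Q 2) (Q 1)"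
    using d[of 1] d[of 2] by simp_all
  interpret Q0: left_module "opposite A" "Q 0" by (rule Q)
  interpret Q1: left_module "opposite A" "Q 1" by (rule Q)
  have coord_add: "\<rho> (x \<oplus>\<^bsub>M\<^esub> y) = \<rho> x \<oplus> \<rho> y" if "x \<in> carrier M" "y \<in> carrier M" for x y
    using mod_hom_add[OF coord that] by simp
  have coord_smult: "\<rho> (a \<odot>\<^bsub>M\<^esub> x) = \<rho> x \<otimes> a" if "x \<in> carrier M" "a \<in> carrier A" for x a
    using mod_hom_smult[OF coord, of a x] that by simp
  have coord_zero: "\<rho> \<zero>\<^bsub>M\<^esub> = \<zero>"
    using coord_smult[OF M.M.zero_closed zero_closed] coord_closed[OF M.M.zero_closed]
    by (simp add: M.smult_zero_right)
  have char_coord: "(\<epsilon> \<circ> \<rho>) \<in> mod_hom (opposite A) M (character_module \<epsilon>)"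
    by (rule mod_homI) (simp_all add: coord_add coord_smult char_add char_mult coord_closed)
  have char_coord_onto: "(\<epsilon> \<circ> \<rho>) ` carrier M = carrier (character_module \<epsilon>)"
  proof -
    have "z = (\<epsilon> \<circ> \<rho>) (scal A z \<odot>\<^bsub>M\<^esub> e)" for z
      by (simp add: coord_smult gen_closed scal_closed coord_gen char_scal)
    moreover have "scal A z \<odot>\<^bsub>M\<^esub> e \<in> carrier M" for z
      using M.smult_closed[of "scal A z" e] by (simp add: scal_closed gen_closed)
    ultimately show ?thesis
      by (auto intro: image_eqI)
  qed
  obtain h where h: "h \<in> mod_hom (opposite A) (Q 0) M"
    and lift: "\<And>x. x \<in> carrier (Q 0) \<Longrightarrow> (\<epsilon> \<circ> \<rho>) (h x) = \<pi> x"
  proof (rule projective_lift[OF proj M.left_module_axioms \<pi>(3) _ char_coord char_coord_onto \<pi>(1)])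
    show "\<one>\<^bsub>opposite A\<^esub> \<noteq> \<zero>\<^bsub>opposite A\<^esub>"
      by (simp add: one_not_zero)
  qed blast
  define k where "k x = \<rho> (h x)" for x
  have k_closed: "k x \<in> carrier A" if "x \<in> carrier (Q 0)" for x
    using that by (simp add: k_def coord_closed mod_hom_closed[OF h])
  have k_add: "k (x \<oplus>\<^bsub>Q 0\<^esub> y) = k x \<oplus> k y" if "x \<in> carrier (Q 0)" "y \<in> carrier (Q 0)" for x y
    using that by (simp add: k_def mod_hom_add[OF h] coord_add mod_hom_closed[OF h])
  have k_smult: "k (a \<odot>\<^bsub>Q 0\<^esub> x) = k x \<otimes> a" if "x \<in> carrier (Q 0)" "a \<in> carrier A" for x a
    using that by (simp add: k_def mod_hom_smult[OF h] coord_smult mod_hom_closed[OF h])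
  have k_zero: "k \<zero>\<^bsub>Q 0\<^esub> = \<zero>"
    using mod_hom_zero[OF Q0.M.abelian_group_axioms M.M.abelian_group_axioms h]
    by (simp add: k_def coord_zero)
  have k_char: "\<epsilon> (k x) = \<pi> x" if "x \<in> carrier (Q 0)" for x
    using lift[OF that] by (simp add: k_def)
  have d1_closed: "d 1 x \<in> carrier (Q 0)" and d1_char: "\<epsilon> (k (d 1 x)) = 0" if "x \<in> carrier (Q 1)" for x
  proof -
    have "d 1 x \<in> {x \<in> carrier (Q 0). \<pi> x = 0}"
      using that by (simp add: exact0)
    then show "d 1 x \<in> carrier (Q 0)" "\<epsilon> (k (d 1 x)) = 0"
      by (simp_all add: k_char)
  qed
  have gen_smult: "a \<odot>\<^bsub>M\<^esub> e \<in> carrier M" if "a \<in> carrier A" for a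
    using M.smult_closed[of a e] that by (simp add: gen_closed)
  define f where "f = (\<lambda>x\<in>carrier (Q 1). D (k (d 1 x)) \<odot>\<^bsub>M\<^esub> e)"
  define z where "z = (\<lambda>x\<in>carrier (Q 1). \<zero>\<^bsub>M\<^esub>)"
  let ?H = "precomp (Q 1) (d 1) ` carrier (hom_space A (Q 0) M)"
  let ?Z = "{g \<in> carrier (hom_space A (Q 1) M).
    precomp (Q 2) (d 2) g = \<zero>\<^bsub>hom_space A (Q 2) M\<^esub>}"
  have "f \<in> mod_hom (opposite A) (Q 1) M"
  proof (rule mod_homI)
    fix x assume x: "x \<in> carrier (Q 1)"
    note closed = d1_closed k_closed deriv_closed gen_smult Q1.M.a_closed
    show "f x \<in> carrier M"
      using x by (simp add: f_def closed)
    show "f (x \<oplus>\<^bsub>Q 1\<^esub> y) = f x \<oplus>\<^bsub>M\<^esub> f y" if y: "y \<in> carrier (Q 1)" for y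
      using x y M.smult_l_distr[of "D (k (d 1 x))" "D (k (d 1 y))" e]
      by (simp add: f_def mod_hom_add[OF d1] closed k_add deriv_add gen_closed)
    show "f (a \<odot>\<^bsub>Q 1\<^esub> x) = a \<odot>\<^bsub>M\<^esub> f x" if "a \<in> carrier (opposite A)" for a
    proof -
      have a: "a \<in> carrier A" using that by simp
      \<comment> \<open>The second term of the product rule carries the factor \<epsilon>(k(d 1 x))
        = 0, by exactness at \<open>Q 0\<close>.\<close>
      have "D (k (d 1 (a \<odot>\<^bsub>Q 1\<^esub> x))) = D (k (d 1 x)) \<otimes> a"
        using x a by (simp add: mod_hom_smult[OF d1] k_smult closed deriv_mult d1_char scal_zero)
      then show ?thesis
        using x a that M.smult_assoc[of a "D (k (d 1 x))" e] Q1.smult_closed[OF that x]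
        by (simp add: f_def closed gen_closed)
    qed
  qed
  moreover have "precomp (Q 2) (d 2) f = \<zero>\<^bsub>hom_space A (Q 2) M\<^esub>"
  proof -
    have "f (d 2 x) = \<zero>\<^bsub>M\<^esub>" if "x \<in> carrier (Q 2)" for x
    proof -
      have "d 2 x \<in> {x \<in> carrier (Q 1). d 1 x = \<zero>\<^bsub>Q 0\<^esub>}"
        using that by (simp add: exact1)
      then show ?thesis
        by (simp add: f_def k_zero deriv_zero M.smult_zero_left[simplified] gen_closed)
    qed
    then show ?thesis
      by (auto simp: precomp_def hom_space_def intro!: restrict_ext)
  qed
  ultimately have f: "f \<in> ?Z"
    by (simp add: hom_space_def f_def)
  have zero_hom: "(\<lambda>x\<in>carrier L. \<zero>\<^bsub>M\<^esub>) \<in> carrier (hom_space A L M)"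
    if "left_module (opposite A) L" for L :: "('a, 'b) module"
  proof -
    interpret L: left_module "opposite A" L by fact
    show ?thesis
      using L.smult_closed M.smult_zero_right by (auto simp: hom_space_def intro!: mod_homI)
  qed
  have "precomp (Q 2) (d 2) z = \<zero>\<^bsub>hom_space A (Q 2) M\<^esub>"
    by (auto simp: precomp_def hom_space_def z_def mod_hom_closed[OF d2] intro!: restrict_ext)
  then have z: "z \<in> ?Z"
    using zero_hom[OF Q, of 1] by (simp add: z_def)
  have "precomp (Q 1) (d 1) (\<lambda>x\<in>carrier (Q 0). \<zero>\<^bsub>M\<^esub>) = z"
    by (auto simp: precomp_def z_def mod_hom_closed[OF d1] intro!: restrict_ext)
  then have zH: "z \<in> ?H"
    using zero_hom[OF Q, of 0] by (intro image_eqI[of _ _ "\<lambda>x\<in>carrier (Q 0). \<zero>\<^bsub>M\<^esub>"]) auto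
  let ?coset = "\<lambda>g. \<Union>u\<in>?H. {u \<oplus>\<^bsub>hom_space A (Q 1) M\<^esub> g}"
  have carrier: "carrier (Ext A Q d 1 M) = ?coset ` ?Z"
    by (simp add: Ext_def homology_at_def a_rcosets_eq a_r_coset_def')
  have "?coset f \<noteq> ?coset z"
  proof
    assume eq: "?coset f = ?coset z"
    \<comment> \<open>The zero map \<open>z\<close> is itself a coboundary, so \<open>f\<close> lies
      in its own coset. Equality of the two cosets would thus make \<open>f\<close> a
      coboundary.\<close>
    have "z \<oplus>\<^bsub>hom_space A (Q 1) M\<^esub> f = f"
      using f
      by (auto simp: hom_space_def z_def fun_eq_iff restrict_def extensional_def mod_hom_def Pi_iff)
    then have "f \<in> ?coset f"
      by (intro UN_I[OF zH]) (simp only: singleton_iff)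
    then have "f \<in> ?coset z"
      by (simp only: eq)
    then obtain g where g: "g \<in> carrier (hom_space A (Q 0) M)"
      and fg: "f = precomp (Q 1) (d 1) g \<oplus>\<^bsub>hom_space A (Q 1) M\<^esub> z"
      by blast
    have g': "g \<in> mod_hom (opposite A) (Q 0) M"
      using g by (simp add: hom_space_def)
    have "1 \<in> \<pi> ` carrier (Q 0)"
      by (simp add: \<pi>(2))
    \<comment> \<open>The element pb has augmentation \<pi>(p)\<epsilon>(b) = 0 and so equals
      \<open>d 1 x\<close> for some x. At this x both \<open>f\<close> and the coboundary of
      \<open>g\<close> can be computed.\<close>
    then obtain p where p: "p \<in> carrier (Q 0)" "\<pi> p = 1"
      by auto
    have bp: "b \<odot>\<^bsub>Q 0\<^esub> p \<in> carrier (Q 0)"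
      using Q0.smult_closed[of b p] p b by simp
    have "\<pi> (b \<odot>\<^bsub>Q 0\<^esub> p) = 0"
      using mod_hom_smult[OF \<pi>(1), of b p] p b by simp
    then have "b \<odot>\<^bsub>Q 0\<^esub> p \<in> d 1 ` carrier (Q 1)"
      using exact0 bp by blast
    then obtain x where x: "x \<in> carrier (Q 1)" "b \<odot>\<^bsub>Q 0\<^esub> p = d 1 x"
      by blast
    have "f x = g (d 1 x)"
      using x(1) mod_hom_closed[OF g' d1_closed[OF x(1)]]
      by (simp add: fg precomp_def hom_space_def z_def)
    then have "D (k p \<otimes> b) \<odot>\<^bsub>M\<^esub> e = b \<odot>\<^bsub>M\<^esub> g p"
      using x(1) p b by (simp add: f_def x(2)[symmetric] k_smult mod_hom_smult[OF g'])
    then have "\<rho> (D (k p \<otimes> b) \<odot>\<^bsub>M\<^esub> e) = \<rho> (b \<odot>\<^bsub>M\<^esub> g p)"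
      by simp
    then have "D (k p \<otimes> b) = \<rho> (g p) \<otimes> b"
      using p b by (simp add: coord_smult gen_closed deriv_closed k_closed coord_gen mod_hom_closed[OF g'])
    then have "D (k p) \<otimes> b \<oplus> D b = \<rho> (g p) \<otimes> b"
      using p b by (simp add: deriv_mult k_closed k_char scal_one deriv_closed)
    \<comment> \<open>Every term with right factor b dies under \<open>\<epsilon>\<close>, whatever
      k(p) and g(p) are; \<epsilon>(D b) alone remains and would have to be 0.\<close>
    then have "\<epsilon> (D (k p) \<otimes> b \<oplus> D b) = \<epsilon> (\<rho> (g p) \<otimes> b)"
      by simp
    then show False
      using p b by (simp add: char_add char_mult deriv_closed k_closed coord_closed mod_hom_closed[OF g'])
  qed
  moreover have "?coset f \<in> carrier (Ext A Q d 1 M)"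
    unfolding carrier by (rule imageI[OF f])
  moreover have "?coset z \<in> carrier (Ext A Q d 1 M)"
    unfolding carrier by (rule imageI[OF z])
  ultimately show ?thesis
    by (rule that[rotated 2])
qed

text \<open>The contradiction comes from surjectivity of \<open>\<phi> 2 M\<close>: a set with at
  most one element cannot map onto one with two.\<close>

theorem no_poincare_duality_3:
  fixes \<phi> :: "int \<Rightarrow> ('a, 'm) module \<Rightarrow> ('m \<times> 'p \<Rightarrow> complex) set set \<Rightarrow> ('q \<Rightarrow> 'm) set"
  assumes P: "projective_resolution A N P dP eP"
    and Q: "projective_resolution (opposite A) (character_module \<epsilon>) Q dQ eQ"
  shows "\<not> poincare_duality_3 A P dP Q dQ \<phi>"
proof
  assume "poincare_duality_3 A P dP Q dQ \<phi>"
  then have "\<phi> 2 M \<in> mod_iso complex_ring (Tor A P dP 2 M) (Ext A Q dQ (3 - 2) M)"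
    using right_module unfolding poincare_duality_3_def by blast
  then have onto: "\<phi> 2 M ` carrier (Tor A P dP 2 M) = carrier (Ext A Q dQ 1 M)"
    by (auto simp: mod_iso_def bij_betw_def)
  have "X = Y" if XY: "X \<in> carrier (Ext A Q dQ 1 M)" "Y \<in> carrier (Ext A Q dQ 1 M)" for X Y
  proof -
    obtain X' Y' where "X' \<in> carrier (Tor A P dP 2 M)" "Y' \<in> carrier (Tor A P dP 2 M)"
      "X = \<phi> 2 M X'" "Y = \<phi> 2 M Y'"
      using XY unfolding onto[symmetric] by blast
    then show ?thesis
      using Tor_trivial[OF P, of 2 X' Y'] by simp
  qed
  then show False
    using Ext_1_nontrivial[OF Q] by metis
qed

end

text \<open>The duality statement ranges over modules with elements in one fixed type, so the
  regular module is copied into that type along an injection.\<close>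

definition transported_regular :: "('a, 'c) ring_scheme \<Rightarrow> ('a \<Rightarrow> 'm) \<Rightarrow> ('a, 'm) module" where
  "transported_regular R \<iota> = (let \<rho> = inv_into (carrier R) \<iota> in
     \<lparr>carrier = \<iota> ` carrier R, mult = undefined, one = undefined, zero = \<iota> \<zero>\<^bsub>R\<^esub>,
      add = (\<lambda>x y. \<iota> (\<rho> x \<oplus>\<^bsub>R\<^esub> \<rho> y)), smult = (\<lambda>a x. \<iota> (\<rho> x \<otimes>\<^bsub>R\<^esub> a))\<rparr>)"

lemma (in complex_algebra) rank_one_module_transported_regular:
  assumes "inj_on \<iota> (carrier A)"
  shows "rank_one_module A (transported_regular A \<iota>) (\<iota> \<one>) (inv_into (carrier A) \<iota>)"
proof -
  note [simp] = inv_into_f_f[OF assms] transported_regular_def Let_def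
  have "right_module A (transported_regular A \<iota>)"
    by (intro left_module.intro left_module_axioms.intro ring_opposite abelian_groupI)
      (auto simp: a_ac m_assoc l_distr r_distr intro!: bexI[of _ "\<ominus> _"] arg_cong[of _ _ \<iota>] r_neg)
  then show ?thesis
    by (intro rank_one_module.intro rank_one_module_axioms.intro complex_algebra_axioms mod_homI) auto
qed

section \<open>Convolution on words\<close>

text \<open>The value at \<open>v\<close> of the linear functional given on basis elements by
  \<open>\<phi>\<close>. Counit, coordinates and, pointwise, the derivation are instances, so their
  identities reduce to words.\<close>

definition lin :: "('s \<Rightarrow> complex) \<Rightarrow> ('s \<Rightarrow> complex) \<Rightarrow> complex" where
  "lin \<phi> v = (\<Sum>s | v s \<noteq> 0. v s * \<phi> s)"

lemma lin_superset: "finite T \<Longrightarrow> {s. v s \<noteq> 0} \<subseteq> T \<Longrightarrow> lin \<phi> v = (\<Sum>s\<in>T. v s * \<phi> s)"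
  unfolding lin_def by (auto intro!: sum.mono_neutral_left)

lemma lin_add:
  assumes "finite {s. v s \<noteq> 0}" "finite {s. w s \<noteq> 0}"
  shows "lin \<phi> (\<lambda>s. v s + w s) = lin \<phi> v + lin \<phi> w"
proof -
  let ?T = "{s. v s \<noteq> 0} \<union> {s. w s \<noteq> 0}"
  have T: "finite ?T" using assms by simp
  show ?thesis
    by (subst (1 2 3) lin_superset[OF T]) (auto simp: sum.distrib distrib_right)
qed

lemma lin_smult: "lin \<phi> (\<lambda>s. c * v s) = c * lin \<phi> v"
  by (cases "c = 0") (auto simp: lin_def sum_distrib_left mult.assoc)

lemma lin_single: "lin \<phi> (single s) = \<phi> s"
  by (subst lin_superset[of "{s}"]) (auto simp: single_def)

lemma finite_support_single: "finite {t. single s t \<noteq> 0}"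
  by (rule finite_subset[of _ "{s}"]) (auto simp: single_def)

lemma lin_eval: "finite {s. v s \<noteq> 0} \<Longrightarrow> lin (\<lambda>s. single s t) v = v t"
  unfolding lin_def single_def by (simp add: if_distrib sum.If_cases cong: if_cong)

lemma lin_fun_add: "lin (\<lambda>s. \<phi> s + \<psi> s) v = lin \<phi> v + lin \<psi> v"
  by (simp add: lin_def sum.distrib distrib_left)

lemma lin_fun_smult: "lin (\<lambda>s. c * \<phi> s) v = c * lin \<phi> v"
  by (simp add: lin_def sum_distrib_left mult_ac)

definition conv :: "('l list \<Rightarrow> complex) \<Rightarrow> ('l list \<Rightarrow> complex) \<Rightarrow> 'l list \<Rightarrow> complex" where
  "conv v w s = (\<Sum>k\<le>length s. v (take k s) * w (drop k s))"

text \<open>The cut positions of t correspond to the factorisations t = s @ s'. Hence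
  \<open>conv\<close> is the bilinear extension of concatenation.\<close>

lemma conv_eq_sum:
  assumes "finite S" "{s. v s \<noteq> 0} \<subseteq> S" "finite T" "{s. w s \<noteq> 0} \<subseteq> T"
  shows "conv v w t = (\<Sum>s\<in>S. \<Sum>s'\<in>T. if s @ s' = t then v s * w s' else 0)"
proof -
  have "p \<in> (\<lambda>k. (take k t, drop k t)) ` {..length t}" if "fst p @ snd p = t" for p
  proof (rule image_eqI)
    show "p = (take (length (fst p)) t, drop (length (fst p)) t)"
      by (simp add: that[symmetric])
    show "length (fst p) \<in> {..length t}"
      by (simp add: that[symmetric])
  qed
  then have "finite {p. fst p @ snd p = t}"
    by (intro finite_subset[OF subsetI finite_imageI[OF finite_atMost]]) (simp only: mem_Collect_eq)
  then have "(\<Sum>p\<in>{p. fst p @ snd p = t}. v (fst p) * w (snd p)) =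
      (\<Sum>p\<in>S \<times> T \<inter> {p. fst p @ snd p = t}. v (fst p) * w (snd p))"
    using assms(2,4) by (intro sum.mono_neutral_right) auto
  also have "\<dots> = (\<Sum>p\<in>S \<times> T. if fst p @ snd p = t then v (fst p) * w (snd p) else 0)"
    using assms(1,3) by (subst sum.inter_restrict) auto
  also have "\<dots> = (\<Sum>s\<in>S. \<Sum>s'\<in>T. if s @ s' = t then v s * w s' else 0)"
    by (simp add: sum.cartesian_product case_prod_beta)
  moreover have "conv v w t = (\<Sum>p\<in>{p. fst p @ snd p = t}. v (fst p) * w (snd p))"
    unfolding conv_def
    by (rule sum.reindex_bij_witness[of _ "\<lambda>p. length (fst p)" "\<lambda>k. (take k t, drop k t)"]) auto
  ultimately show ?thesis by simp
qed

lemma conv_support: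
  assumes "conv v w t \<noteq> 0"
  obtains s s' where "t = s @ s'" "v s \<noteq> 0" "w s' \<noteq> 0"
proof -
  obtain k where "v (take k t) * w (drop k t) \<noteq> 0"
    using assms unfolding conv_def by (rule sum.not_neutral_contains_not_neutral)
  then show ?thesis
    using that[of "take k t" "drop k t"] by simp
qed

lemma finite_support_conv:
  assumes "finite {s. v s \<noteq> 0}" "finite {s. w s \<noteq> 0}"
  shows "finite {s. conv v w s \<noteq> 0}"
  by (rule finite_subset[of _ "(\<lambda>(s, s'). s @ s') ` ({s. v s \<noteq> 0} \<times> {s. w s \<noteq> 0})"])
    (use assms in \<open>auto elim!: conv_support\<close>)

text \<open>Exchanging sums turns a functional of a product into a sum over pairs of words. The
  product rules for counit and derivation are derived from this.\<close>

lemma lin_conv: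
  assumes fin: "finite {s. v s \<noteq> 0}" "finite {s. w s \<noteq> 0}"
  shows "lin \<phi> (conv v w) = lin (\<lambda>s. lin (\<lambda>s'. \<phi> (s @ s')) w) v"
proof -
  let ?S = "{s. v s \<noteq> 0}" and ?T = "{s. w s \<noteq> 0}"
  let ?U = "(\<lambda>(s, s'). s @ s') ` (?S \<times> ?T)"
  have U: "finite ?U" using fin by simp
  have "lin \<phi> (conv v w) = (\<Sum>t\<in>?U. conv v w t * \<phi> t)"
    using U by (rule lin_superset) (auto elim!: conv_support)
  also have "\<dots> = (\<Sum>t\<in>?U. \<Sum>s\<in>?S. \<Sum>s'\<in>?T. if s @ s' = t then v s * w s' * \<phi> t else 0)"
    by (subst conv_eq_sum[OF fin(1) order_refl fin(2) order_refl])
      (auto simp: sum_distrib_right intro!: sum.cong)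
  also have "\<dots> = (\<Sum>s\<in>?S. \<Sum>t\<in>?U. \<Sum>s'\<in>?T. if s @ s' = t then v s * w s' * \<phi> t else 0)"
    by (rule sum.swap)
  also have "\<dots> = (\<Sum>s\<in>?S. \<Sum>s'\<in>?T. \<Sum>t\<in>?U. if s @ s' = t then v s * w s' * \<phi> t else 0)"
    by (intro sum.cong[OF refl] sum.swap)
  also have "\<dots> = (\<Sum>s\<in>?S. \<Sum>s'\<in>?T. v s * w s' * \<phi> (s @ s'))"
    using U by (intro sum.cong refl) (auto simp: image_iff)
  also have "\<dots> = lin (\<lambda>s. lin (\<lambda>s'. \<phi> (s @ s')) w) v"
    by (simp add: lin_def sum_distrib_left mult.assoc)
  finally show ?thesis .
qed

lemma conv_eq_lin:
  "finite {s. v s \<noteq> 0} \<Longrightarrow> finite {s. w s \<noteq> 0} \<Longrightarrow>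
    conv v w t = lin (\<lambda>s. lin (\<lambda>s'. single (s @ s') t) w) v"
  by (subst lin_conv[symmetric]) (simp_all add: lin_eval finite_support_conv)

text \<open>Both coordinates at t are the trilinear extension of
  \<open>single (s @ s' @ s'') t\<close>, so the claim is associativity of concatenation.\<close>

lemma conv_assoc:
  assumes "finite {s. u s \<noteq> 0}" "finite {s. v s \<noteq> 0}" "finite {s. w s \<noteq> 0}"
  shows "conv (conv u v) w = conv u (conv v w)"
proof
  fix t
  have "conv (conv u v) w t = lin (\<lambda>s. lin (\<lambda>s'. single (s @ s') t) w) (conv u v)"
    using assms by (intro conv_eq_lin finite_support_conv)
  also have "\<dots> = lin (\<lambda>s. lin (\<lambda>s'. single (s @ s') t) (conv v w)) u"
    using assms by (simp add: lin_conv)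
  also have "\<dots> = conv u (conv v w) t"
    using assms by (intro conv_eq_lin[symmetric] finite_support_conv)
  finally show "conv (conv u v) w t = conv u (conv v w) t" .
qed

lemma conv_single_Nil:
  assumes "finite {s. v s \<noteq> 0}"
  shows "conv (single []) v = v" "conv v (single []) = v"
  using assms by (auto simp: conv_eq_lin finite_support_single lin_single lin_eval fun_eq_iff)

lemma conv_single: "conv (single s) (single s') = single (s @ s')"
  by (auto simp: conv_eq_lin finite_support_single lin_single fun_eq_iff)

lemma conv_add_left: "conv (\<lambda>s. u s + v s) w t = conv u w t + conv v w t"
  and conv_add_right: "conv w (\<lambda>s. u s + v s) t = conv w u t + conv w v t"
  and conv_smult_left: "conv (\<lambda>s. c * u s) w t = c * conv u w t"
  by (simp_all add: conv_def sum.distrib algebra_simps sum_distrib_left)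

section \<open>The counit and the derivation on the free algebra\<close>

definition word_counit :: "letter list \<Rightarrow> complex" where
  "word_counit w = prod_list (map letter_counit w)"

lemma word_counit_simps [simp]:
  "word_counit [] = 1" "word_counit (l # w) = letter_counit l * word_counit w"
  "word_counit (w @ w') = word_counit w * word_counit w'"
  by (simp_all add: word_counit_def)

lemma free_counit_eq_lin: "free_counit = lin word_counit"
  by (simp add: free_counit_def lin_def word_counit_def fun_eq_iff)

text \<open>The recursion is the product rule at the first letter, D(lw) = D(l)w +
  \<epsilon>(l)D(w). In the clause for \<open>Gen\<close> the common factor is both D(l) and
  \<epsilon>(l), which agree on these letters.\<close>

fun word_deriv :: "letter list \<Rightarrow> free_elem" where
  "word_deriv [] t = 0"
| "word_deriv (Gen i j # w) t = letter_counit (Gen i j) * (single w t + word_deriv w t)"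
| "word_deriv (GenStar i j # w) t =
     letter_counit (GenStar i j) * word_deriv w t - single (GenStar i j # w) t"

definition free_deriv :: "free_elem \<Rightarrow> free_elem" where
  "free_deriv v t = lin (\<lambda>s. word_deriv s t) v"

text \<open>The definition gives the product rule for a first factor of one letter; induction on
  \<open>s\<close> extends it to any word.\<close>

lemma word_deriv_append:
  "word_deriv (s @ s') t = conv (word_deriv s) (single s') t + word_counit s * word_deriv s' t"
proof (induction s arbitrary: t)
  case Nil
  then show ?case by (simp add: conv_def)
next
  case (Cons l s)
  show ?case
  proof (cases l)
    case l: (Gen i j)
    \<comment> \<open>The equations of \<open>word_deriv\<close> rewrite only applied occurrences,
      so the first factor is replaced by an explicit abstraction before using linearity of
      \<open>conv\<close>.\<close>
    have "conv (word_deriv (Gen i j # s)) (single s') t =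
        conv (\<lambda>t. letter_counit (Gen i j) * (single s t + word_deriv s t)) (single s') t"
      by (rule arg_cong[of _ _ "\<lambda>f. conv f _ _"]) auto
    also have "\<dots> = letter_counit (Gen i j) * (single (s @ s') t + conv (word_deriv s) (single s') t)"
      by (simp only: conv_smult_left conv_add_left conv_single)
    finally show ?thesis
      by (simp only: l append_Cons) (simp add: Cons algebra_simps)
  next
    case l: (GenStar i j)
    have "conv (word_deriv (GenStar i j # s)) (single s') t =
        conv (\<lambda>t. letter_counit (GenStar i j) * word_deriv s t + (- 1) * single (GenStar i j # s) t)
          (single s') t"
      by (rule arg_cong[of _ _ "\<lambda>f. conv f _ _"]) auto
    also have "\<dots> = letter_counit (GenStar i j) * conv (word_deriv s) (single s') t
        - single (GenStar i j # s @ s') t"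
      by (simp only: conv_smult_left conv_add_left conv_single) simp
    finally show ?thesis
      by (simp only: l append_Cons) (simp add: Cons algebra_simps)
  qed
qed

text \<open>Each recursion step adds at most the words \<open>w\<close> and \<open>l # w\<close>.
  This keeps the derivation finitely supported and within the letters already present.\<close>

lemma word_deriv_support:
  "finite {t. word_deriv w t \<noteq> 0}" "word_deriv w t \<noteq> 0 \<Longrightarrow> set t \<subseteq> set w"
proof -
  have "finite {t. word_deriv w t \<noteq> 0} \<and> (\<forall>t. word_deriv w t \<noteq> 0 \<longrightarrow> set t \<subseteq> set w)"
  proof (induction w)
    case (Cons l w)
    have *: "word_deriv w t \<noteq> 0 \<or> t = w \<or> t = l # w" if "word_deriv (l # w) t \<noteq> 0" for t
      using that by (cases l) (auto simp: single_def split: if_splits)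
    have "finite ({t. word_deriv w t \<noteq> 0} \<union> {w, l # w})"
      using Cons by simp
    then have "finite {t. word_deriv (l # w) t \<noteq> 0}"
      by (rule finite_subset[rotated]) (use * in auto)
    moreover have "set t \<subseteq> set (l # w)" if "word_deriv (l # w) t \<noteq> 0" for t
      using *[OF that] Cons by auto
    ultimately show ?case by blast
  qed simp
  then show "finite {t. word_deriv w t \<noteq> 0}" "word_deriv w t \<noteq> 0 \<Longrightarrow> set t \<subseteq> set w"
    by auto
qed

text \<open>The rule for words extends bilinearly: \<open>right\<close> and \<open>left\<close> pull
  linear combinations through the second and the first factor of \<open>conv\<close>.\<close>

lemma free_deriv_conv:
  assumes fin: "finite {s. v s \<noteq> 0}" "finite {s. w s \<noteq> 0}"
  shows "free_deriv (conv v w) t = conv (free_deriv v) w t + free_counit v * free_deriv w t"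
proof -
  have right: "lin (\<lambda>s'. conv x (single s') t) w = conv x w t" for x
  proof -
    have "lin (\<lambda>s'. conv x (single s') t) w =
        (\<Sum>k\<le>length t. x (take k t) * lin (\<lambda>s'. single s' (drop k t)) w)"
      unfolding lin_def conv_def sum_distrib_left by (subst sum.swap) (simp add: mult_ac)
    then show ?thesis
      using fin(2) by (simp add: lin_eval conv_def)
  qed
  have left: "lin (\<lambda>s. conv (word_deriv s) w t) v = conv (free_deriv v) w t"
    unfolding lin_def conv_def free_deriv_def sum_distrib_left sum_distrib_right
    by (subst sum.swap) (simp add: mult_ac)
  have "free_deriv (conv v w) t = lin (\<lambda>s. conv (word_deriv s) w t + word_counit s * free_deriv w t) v"
    unfolding free_deriv_def using fin
    by (simp add: lin_conv word_deriv_append lin_fun_add lin_fun_smult right)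
  then show ?thesis
    using lin_fun_smult[of "free_deriv w t" word_counit v]
    by (simp add: lin_fun_add left free_counit_eq_lin mult.commute)
qed

lemma free_counit_conv:
  assumes "finite {s. v s \<noteq> 0}" "finite {s. w s \<noteq> 0}"
  shows "free_counit (conv v w) = free_counit v * free_counit w"
proof -
  have "free_counit (conv v w) = lin (\<lambda>s. word_counit s * free_counit w) v"
    using assms by (simp add: free_counit_eq_lin lin_conv lin_fun_smult)
  then show ?thesis
    using lin_fun_smult[of "free_counit w" word_counit v]
    by (simp add: free_counit_eq_lin mult.commute)
qed

section \<open>The free algebra and its relations\<close>

lemma free_star_algebra_sel [simp]:
  "zero (free_star_algebra n) = (\<lambda>s. 0)" "add (free_star_algebra n) = (\<lambda>v w s. v s + w s)"
  "smult (free_star_algebra n) = (\<lambda>c v s. c * v s)" "mult (free_star_algebra n) = conv"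
  "one (free_star_algebra n) = single []"
  by (simp_all add: free_star_algebra_def conv_def fun_eq_iff)

lemma carrier_free_star_algebra:
  "v \<in> carrier (free_star_algebra n) \<longleftrightarrow>
    (\<forall>s. v s \<noteq> 0 \<longrightarrow> set s \<subseteq> letters n) \<and> finite {s. v s \<noteq> 0}"
  by (auto simp: free_star_algebra_def carrier_free_module lists_eq_set)

lemma single_in_free_star_algebra: "set s \<subseteq> letters n \<Longrightarrow> single s \<in> carrier (free_star_algebra n)"
  by (auto simp: carrier_free_star_algebra finite_support_single single_def)

lemma abelian_group_free_star_algebra: "abelian_group (free_star_algebra n)"
proof -
  interpret F: abelian_group "free_module complex_ring (lists (letters n))"
    by (rule abelian_group_free_complex)
  have "add_monoid (free_star_algebra n) = add_monoid (free_module complex_ring (lists (letters n)))"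
    by (simp add: free_star_algebra_def)
  then show ?thesis
    using F.a_comm_group by (intro comm_group_abelian_groupI) simp
qed

lemma ring_free_star_algebra: "ring (free_star_algebra n)"
proof (intro ringI abelian_group_free_star_algebra monoidI)
  show "v \<otimes>\<^bsub>free_star_algebra n\<^esub> w \<in> carrier (free_star_algebra n)"
    if "v \<in> carrier (free_star_algebra n)" "w \<in> carrier (free_star_algebra n)" for v w
    unfolding carrier_free_star_algebra free_star_algebra_sel
  proof (intro conjI allI impI)
    fix t assume "conv v w t \<noteq> 0"
    then show "set t \<subseteq> letters n"
      by (rule conv_support) (use that in \<open>simp add: carrier_free_star_algebra\<close>)
  qed (use that in \<open>auto simp: carrier_free_star_algebra intro: finite_support_conv\<close>)
  show "\<one>\<^bsub>free_star_algebra n\<^esub> \<in> carrier (free_star_algebra n)"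
    using single_in_free_star_algebra[of "[]" n] by simp
qed (simp_all add: carrier_free_star_algebra conv_assoc conv_single_Nil conv_add_left conv_add_right
    fun_eq_iff)

interpretation free_star_algebra: ring "free_star_algebra n" for n
  by (rule ring_free_star_algebra)

lemma free_star_algebra_finite: "v \<in> carrier (free_star_algebra n) \<Longrightarrow> finite {s. v s \<noteq> 0}"
  by (simp add: carrier_free_star_algebra)

text \<open>Writing a scalar multiple as a product with a multiple of the unit shows that ideals,
  which are defined through ring operations only, are closed under scalars.\<close>

lemma smult_free_star_algebra:
  assumes "v \<in> carrier (free_star_algebra n)"
  shows "(\<lambda>s. c * v s) = conv (\<lambda>s. c * single [] s) v"
    and "(\<lambda>s. c * v s) \<in> carrier (free_star_algebra n)"
proof -
  show "(\<lambda>s. c * v s) = conv (\<lambda>s. c * single [] s) v"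
    using assms by (simp add: fun_eq_iff conv_smult_left conv_single_Nil free_star_algebra_finite)
  show "(\<lambda>s. c * v s) \<in> carrier (free_star_algebra n)"
    using assms by (auto simp: carrier_free_star_algebra elim: finite_subset[rotated])
qed

lemma a_inv_free_star_algebra:
  assumes "v \<in> carrier (free_star_algebra n)"
  shows "\<ominus>\<^bsub>free_star_algebra n\<^esub> v = (\<lambda>s. - v s)"
  using smult_free_star_algebra(2)[OF assms, of "- 1"] assms
  by (intro free_star_algebra.minus_equality) auto

lemma minus_free_star_algebra:
  "w \<in> carrier (free_star_algebra n) \<Longrightarrow> v \<ominus>\<^bsub>free_star_algebra n\<^esub> w = (\<lambda>s. v s - w s)"
  by (simp add: a_minus_def a_inv_free_star_algebra)

lemma finsum_free_star_algebra:
  assumes "f \<in> K \<rightarrow> carrier (free_star_algebra n)" "finite K"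
  shows "finsum (free_star_algebra n) f K = (\<lambda>s. \<Sum>k\<in>K. f k s)"
  using assms(2,1)
proof (induction K)
  case empty
  then show ?case by simp
next
  case (insert k K)
  then show ?case
    by (subst free_star_algebra.finsum_insert) auto
qed

lemma free_counit_add:
  "v \<in> carrier (free_star_algebra n) \<Longrightarrow> w \<in> carrier (free_star_algebra n) \<Longrightarrow>
    free_counit (\<lambda>s. v s + w s) = free_counit v + free_counit w"
  by (simp add: free_counit_eq_lin lin_add free_star_algebra_finite)

lemma free_deriv_add:
  "v \<in> carrier (free_star_algebra n) \<Longrightarrow> w \<in> carrier (free_star_algebra n) \<Longrightarrow>
    free_deriv (\<lambda>s. v s + w s) = (\<lambda>s. free_deriv v s + free_deriv w s)"
  by (simp add: free_deriv_def lin_add free_star_algebra_finite fun_eq_iff)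

lemma free_deriv_closed:
  assumes "v \<in> carrier (free_star_algebra n)"
  shows "free_deriv v \<in> carrier (free_star_algebra n)"
proof -
  have *: "\<exists>s. v s \<noteq> 0 \<and> word_deriv s t \<noteq> 0" if "free_deriv v t \<noteq> 0" for t
    using that unfolding free_deriv_def lin_def by (auto elim!: sum.not_neutral_contains_not_neutral)
  have "finite (\<Union>s\<in>{s. v s \<noteq> 0}. {t. word_deriv s t \<noteq> 0})"
    using assms by (auto simp: free_star_algebra_finite word_deriv_support)
  then have "finite {t. free_deriv v t \<noteq> 0}"
    by (rule finite_subset[rotated]) (use * in blast)
  moreover have "set t \<subseteq> letters n" if "free_deriv v t \<noteq> 0" for t
    using *[OF that] assms word_deriv_support(2) by (fastforce simp: carrier_free_star_algebra)
  ultimately show ?thesis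
    by (simp add: carrier_free_star_algebra)
qed

text \<open>One shape for the entries of all four matrix relations: \<open>w k\<close> is the k-th
  summand of the matrix product and \<open>c\<close> tells whether the entry is on the
  diagonal.\<close>

definition unitary_rel :: "nat \<Rightarrow> (nat \<Rightarrow> letter list) \<Rightarrow> bool \<Rightarrow> free_elem" where
  "unitary_rel n w c s = (\<Sum>k\<in>{1..n}. single (w k) s) - (if c then single [] s else 0)"

text \<open>
  The summands of the \<open>(i, j)\<close> entries of \<open>u u\<^sup>*\<close>, \<open>u\<^sup>* u\<close> and of the same products for the conjugate matrix.
\<close>

definition rel_words :: "nat \<Rightarrow> nat \<Rightarrow> (nat \<Rightarrow> letter list) set" where
  "rel_words i j = {\<lambda>k. [Gen i k, GenStar j k], \<lambda>k. [GenStar k i, Gen k j],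
     \<lambda>k. [GenStar i k, Gen j k], \<lambda>k. [Gen k i, GenStar k j]}"

lemma unitary_rel_support:
  assumes "unitary_rel n w c s \<noteq> 0"
  shows "s \<in> insert [] (w ` {1..n})"
proof (rule ccontr)
  assume s: "s \<notin> insert [] (w ` {1..n})"
  have "single (w k) s = 0" if "k \<in> {1..n}" for k
  proof -
    have "s \<noteq> w k"
      using s imageI[OF that, of w] by blast
    then show ?thesis
      by (simp add: single_def)
  qed
  then have "(\<Sum>k\<in>{1..n}. single (w k) s) = 0"
    by (rule sum.neutral[rule_format])
  moreover have "single [] s = 0"
    using s by (simp add: single_def)
  ultimately have "unitary_rel n w c s = 0"
    unfolding unitary_rel_def by simp
  with assms show False by simp
qed

lemma unitary_rel_closed:
  assumes "\<And>k. k \<in> {1..n} \<Longrightarrow> set (w k) \<subseteq> letters n"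
  shows "unitary_rel n w c \<in> carrier (free_star_algebra n)"
  unfolding carrier_free_star_algebra
proof (intro conjI allI impI)
  show "finite {s. unitary_rel n w c s \<noteq> 0}"
  proof (rule finite_subset)
    show "{s. unitary_rel n w c s \<noteq> 0} \<subseteq> insert [] (w ` {1..n})"
      using unitary_rel_support by blast
  qed simp
  show "set s \<subseteq> letters n" if "unitary_rel n w c s \<noteq> 0" for s
    using unitary_rel_support[OF that]
  proof
    assume "s \<in> w ` {1..n}"
    then obtain k where "k \<in> {1..n}" "s = w k" ..
    then show ?thesis using assms by blast
  qed simp
qed

lemma letters_iff:
  "Gen i j \<in> letters n \<longleftrightarrow> i \<in> {1..n} \<and> j \<in> {1..n}"
  "GenStar i j \<in> letters n \<longleftrightarrow> i \<in> {1..n} \<and> j \<in> {1..n}"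
  by (simp_all add: letters_def)

lemma rel_words_closed:
  "i \<in> {1..n} \<Longrightarrow> j \<in> {1..n} \<Longrightarrow> w \<in> rel_words i j \<Longrightarrow> k \<in> {1..n} \<Longrightarrow> set (w k) \<subseteq> letters n"
  unfolding rel_words_def by (elim insertE emptyE) (simp_all add: letters_iff)

text \<open>The words \<open>w k\<close> may coincide with each other or with the empty word, so the
  value is found by linearity over a common finite set rather than from coefficients.\<close>

lemma lin_unitary_rel: "lin \<phi> (unitary_rel n w c) = (\<Sum>k\<in>{1..n}. \<phi> (w k)) - (if c then \<phi> [] else 0)"
proof -
  let ?T = "insert [] (w ` {1..n})"
  have T: "finite ?T" by simp
  have single: "(\<Sum>s\<in>?T. single u s * \<phi> s) = \<phi> u" if "u \<in> ?T" for u
  proof -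
    have "{s. single u s \<noteq> 0} \<subseteq> ?T"
      using that by (auto simp: single_def split: if_splits)
    from lin_superset[OF T this] show ?thesis
      by (simp only: lin_single)
  qed
  have "{s. unitary_rel n w c s \<noteq> 0} \<subseteq> ?T"
    using unitary_rel_support by blast
  then have "lin \<phi> (unitary_rel n w c) = (\<Sum>s\<in>?T. unitary_rel n w c s * \<phi> s)"
    by (rule lin_superset[OF T])
  also have "\<dots> = (\<Sum>s\<in>?T. \<Sum>k\<in>{1..n}. single (w k) s * \<phi> s) -
      (\<Sum>s\<in>?T. (if c then single [] s else 0) * \<phi> s)"
    by (simp only: unitary_rel_def left_diff_distrib sum_subtractf sum_distrib_right)
  also have "(\<Sum>s\<in>?T. \<Sum>k\<in>{1..n}. single (w k) s * \<phi> s) =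
      (\<Sum>k\<in>{1..n}. \<Sum>s\<in>?T. single (w k) s * \<phi> s)"
    by (rule sum.swap)
  also have "\<dots> = (\<Sum>k\<in>{1..n}. \<phi> (w k))"
    by (intro sum.cong[OF refl] single) simp
  also have "(\<Sum>s\<in>?T. (if c then single [] s else 0) * \<phi> s) = (if c then \<phi> [] else 0)"
    using single[of "[]"] by (cases c) simp_all
  finally show ?thesis .
qed

definition all_rels :: "nat \<Rightarrow> free_elem set" where
  "all_rels n = (\<Union>i\<in>{1..n}. \<Union>j\<in>{1..n}. (\<lambda>w. unitary_rel n w (i = j)) ` rel_words i j)"

lemma unitary_rels_subset: "unitary_rels n \<subseteq> all_rels n"
proof
  fix r assume "r \<in> unitary_rels n"
  then obtain X i j where ij: "i \<in> {1..n}" "j \<in> {1..n}"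
    and r: "r = X i j \<ominus>\<^bsub>free_star_algebra n\<^esub> mat_one n i j"
    and X: "X \<in> {mat_prod n gen_mat (mat_adj gen_mat), mat_prod n (mat_adj gen_mat) gen_mat,
      mat_prod n (mat_conj gen_mat) (mat_adj (mat_conj gen_mat)),
      mat_prod n (mat_adj (mat_conj gen_mat)) (mat_conj gen_mat)}"
    unfolding unitary_rels_def Let_def by blast
  have star: "free_star (single s) = single (map letter_star (rev s))" for s
  proof
    \<comment> \<open>Reversing a word and starring its letters is an involution, so it can be moved
      from the argument of \<open>single\<close> to its index.\<close>
    have "(map letter_star (rev t) = s) = (t = map letter_star (rev s))" for t
    proof -
      have "map letter_star (rev (map letter_star (rev u))) = u" for u
        by (induction u) (auto, metis letter_star.simps letter.exhaust)
      then show ?thesis by metis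
    qed
    then show "free_star (single s) t = single (map letter_star (rev s)) t" for t
      by (simp add: free_star_def single_def)
  qed
  have prod: "(\<Oplus>\<^bsub>free_star_algebra n\<^esub>k\<in>{1..n}. conv (single [a k]) (single [b k]))
      \<ominus>\<^bsub>free_star_algebra n\<^esub> mat_one n i j = unitary_rel n (\<lambda>k. [a k, b k]) (i = j)"
    if "\<And>k. k \<in> {1..n} \<Longrightarrow> a k \<in> letters n \<and> b k \<in> letters n" for a b
  proof -
    have "mat_one n i j \<in> carrier (free_star_algebra n)"
      using free_star_algebra.zero_closed free_star_algebra.one_closed by (auto simp: mat_one_def)
    moreover have "(\<Oplus>\<^bsub>free_star_algebra n\<^esub>k\<in>{1..n}. conv (single [a k]) (single [b k])) =
        (\<lambda>s. \<Sum>k\<in>{1..n}. single [a k, b k] s)"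
      using that by (subst finsum_free_star_algebra) (auto simp: conv_single intro!: single_in_free_star_algebra)
    ultimately show ?thesis
      by (auto simp: minus_free_star_algebra unitary_rel_def mat_one_def fun_eq_iff)
  qed
  note mats = mat_prod_def mat_adj_def mat_conj_def gen_mat_def star letters_iff
  have
    "mat_prod n gen_mat (mat_adj gen_mat) i j \<ominus>\<^bsub>free_star_algebra n\<^esub> mat_one n i j =
      unitary_rel n (\<lambda>k. [Gen i k, GenStar j k]) (i = j)"
    "mat_prod n (mat_adj gen_mat) gen_mat i j \<ominus>\<^bsub>free_star_algebra n\<^esub> mat_one n i j =
      unitary_rel n (\<lambda>k. [GenStar k i, Gen k j]) (i = j)"
    "mat_prod n (mat_conj gen_mat) (mat_adj (mat_conj gen_mat)) i j
        \<ominus>\<^bsub>free_star_algebra n\<^esub> mat_one n i j =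
      unitary_rel n (\<lambda>k. [GenStar i k, Gen j k]) (i = j)"
    "mat_prod n (mat_adj (mat_conj gen_mat)) (mat_conj gen_mat) i j
        \<ominus>\<^bsub>free_star_algebra n\<^esub> mat_one n i j =
      unitary_rel n (\<lambda>k. [Gen k i, GenStar k j]) (i = j)"
    by (subst prod[symmetric]; use ij in \<open>simp add: mats\<close>)+
  with X have "r \<in> (\<lambda>w. unitary_rel n w (i = j)) ` rel_words i j"
    unfolding r rel_words_def by (elim insertE emptyE) simp_all
  then show "r \<in> all_rels n"
    unfolding all_rels_def using ij by blast
qed

section \<open>The algebra of the free unitary quantum group\<close>

lemma free_star_unitary_rel: "free_star (unitary_rel n w c) = unitary_rel n (\<lambda>k. map letter_star (rev (w k))) c"
proof
  fix s
  have inv: "map letter_star (rev (map letter_star (rev u))) = u" for u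
    by (induction u) (auto, metis letter_star.simps letter.exhaust)
  have eq: "(map letter_star (rev s) = u) = (s = map letter_star (rev u))" for u
    using inv by metis
  have "cnj (single u (map letter_star (rev s))) = single (map letter_star (rev u)) s" for u
    by (simp add: single_def eq)
  from this[of "[]"] this show "free_star (unitary_rel n w c) s = unitary_rel n (\<lambda>k. map letter_star (rev (w k))) c s"
    by (simp add: free_star_def unitary_rel_def)
qed

text \<open>A product of a matrix with its adjoint is self-adjoint, so the involution turns the
  relation at (i, j) into the one at (j, i) of the same family.\<close>

lemma unitary_rels_star_subset: "unitary_rels n \<union> free_star ` unitary_rels n \<subseteq> all_rels n"
proof -
  have "free_star r \<in> all_rels n" if "r \<in> all_rels n" for r
  proof -
    obtain w i j where ij: "i \<in> {1..n}" "j \<in> {1..n}" and w: "w \<in> rel_words i j"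
      and r: "r = unitary_rel n w (i = j)"
      using \<open>r \<in> all_rels n\<close> unfolding all_rels_def by blast
    have "(\<lambda>k. map letter_star (rev (w k))) \<in> rel_words j i"
      using w unfolding rel_words_def by (elim insertE emptyE) simp_all
    then have "unitary_rel n (\<lambda>k. map letter_star (rev (w k))) (j = i) \<in> all_rels n"
      unfolding all_rels_def by (intro UN_I[OF ij(2)] UN_I[OF ij(1)]) (rule imageI)
    then show ?thesis
      unfolding r free_star_unitary_rel by (simp only: eq_commute[of i j])
  qed
  with unitary_rels_subset[of n] show ?thesis
    by blast
qed

lemma all_rels_closed: "all_rels n \<subseteq> carrier (free_star_algebra n)"
proof
  fix r assume "r \<in> all_rels n"
  then obtain w i j where ij: "i \<in> {1..n}" "j \<in> {1..n}" "w \<in> rel_words i j" "r = unitary_rel n w (i = j)"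
    unfolding all_rels_def by blast
  then show "r \<in> carrier (free_star_algebra n)"
    using rel_words_closed[OF ij(1-3)] by (simp only: unitary_rel_closed)
qed

text \<open>A summand starting with some u has derivative 0: the letter u contributes the starred
  letter after it, whose own derivative cancels this. A summand starting with a starred letter gives
  a product of two Kronecker symbols minus the word itself; as D(1) = 0, summing over k yields
  -r.\<close>

lemma rels_counit_deriv:
  assumes "r \<in> all_rels n"
  shows "free_counit r = 0" "free_deriv r = (\<lambda>s. 0) \<or> free_deriv r = (\<lambda>s. - r s)"
proof -
  obtain w i j where ij: "i \<in> {1..n}" "j \<in> {1..n}" and w: "w \<in> rel_words i j"
    and r: "r = unitary_rel n w (i = j)"
    using assms unfolding all_rels_def by blast
  have delta: "(\<Sum>k\<in>{1..n}. (if i = k then 1 else 0) * (if j = k then 1 else 0) * z) = (if i = j then z else 0)"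
    for z :: complex
  proof -
    have "(\<Sum>k\<in>{1..n}. (if i = k then 1 else 0) * (if j = k then 1 else 0) * z) =
        (\<Sum>k\<in>{1..n}. if i = k then (if j = k then z else 0) else 0)"
      by (intro sum.cong) auto
    then show ?thesis
      using ij by (simp add: sum.delta')
  qed
  \<comment> \<open>The trailing factor 1 matches the z of \<open>delta\<close>; the derivation uses
    the same sum with \<open>single [] t\<close> as z.\<close>
  have counit: "word_counit (w k) = (if i = k then 1 else 0) * (if j = k then 1 else 0) * 1" for k
    using w unfolding rel_words_def by (elim insertE emptyE) auto
  show "free_counit r = 0"
    unfolding r free_counit_eq_lin lin_unitary_rel counit delta by simp
  have "(\<forall>k t. word_deriv (w k) t = 0) \<or>
    (\<forall>k t. word_deriv (w k) t =
      (if i = k then 1 else 0) * (if j = k then 1 else 0) * single [] t - single (w k) t)"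
    using w unfolding rel_words_def by (elim insertE emptyE) (auto simp: mult.assoc)
  then show "free_deriv r = (\<lambda>s. 0) \<or> free_deriv r = (\<lambda>s. - r s)"
  proof
    assume *: "\<forall>k t. word_deriv (w k) t = 0"
    have "free_deriv r t = 0" for t
      by (simp add: free_deriv_def r lin_unitary_rel *)
    then show ?thesis by auto
  next
    assume *: "\<forall>k t. word_deriv (w k) t =
      (if i = k then 1 else 0) * (if j = k then 1 else 0) * single [] t - single (w k) t"
    have "free_deriv r t = - r t" for t
      unfolding free_deriv_def r lin_unitary_rel *[rule_format] sum_subtractf delta by (simp add: unitary_rel_def)
    then show ?thesis by auto
  qed
qed

lemma ideal_unitary_ideal: "ideal (unitary_ideal n) (free_star_algebra n)"
  unfolding unitary_ideal_def
  using unitary_rels_star_subset all_rels_closed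
  by (intro free_star_algebra.genideal_ideal) blast

text \<open>This lets counit and derivation descend to the quotient. The two claims are proved
  together, because the ideal property of \<open>?J\<close> for the derivation relies on the
  vanishing of the counit.\<close>

lemma unitary_ideal_counit_deriv:
  assumes "v \<in> unitary_ideal n"
  shows "free_counit v = 0" "free_deriv v \<in> unitary_ideal n"
proof -
  interpret I: ideal "unitary_ideal n" "free_star_algebra n"
    by (rule ideal_unitary_ideal)
  note closed = I.a_Hcarr
  let ?J = "{v \<in> unitary_ideal n. free_counit v = 0 \<and> free_deriv v \<in> unitary_ideal n}"
  have add: "(\<lambda>s. v s + w s) \<in> unitary_ideal n" if "v \<in> unitary_ideal n" "w \<in> unitary_ideal n" for v w
    using I.a_closed[OF that] by simp
  have smult: "(\<lambda>s. c * v s) \<in> unitary_ideal n" if "v \<in> unitary_ideal n" for v c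
    using I.I_l_closed[OF that smult_free_star_algebra(2)[OF free_star_algebra.one_closed], of c]
    by (simp add: smult_free_star_algebra(1)[OF closed[OF that]])
  have conv_l: "conv x v \<in> unitary_ideal n" and conv_r: "conv v x \<in> unitary_ideal n"
    if "v \<in> unitary_ideal n" "x \<in> carrier (free_star_algebra n)" for v x
    using I.I_l_closed[OF that] I.I_r_closed[OF that] by simp_all
  have zero: "(\<lambda>s. 0) \<in> unitary_ideal n"
    using I.zero_closed by simp
  have "ideal ?J (free_star_algebra n)"
  proof (rule idealI[OF ring_free_star_algebra])
    show "subgroup ?J (add_monoid (free_star_algebra n))"
    proof (intro subgroup.intro)
      fix v w assume v: "v \<in> ?J"
      show "v \<otimes>\<^bsub>add_monoid (free_star_algebra n)\<^esub> w \<in> ?J" if "w \<in> ?J"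
        using v that by (simp add: add free_counit_add[of _ n] free_deriv_add[of _ n] closed)
      have "lin \<phi> (\<lambda>s. - v s) = - lin \<phi> v" for \<phi>
        using lin_smult[of \<phi> "- 1" v] by simp
      then have "free_counit (\<lambda>s. - v s) = - free_counit v"
        "free_deriv (\<lambda>s. - v s) = (\<lambda>s. - free_deriv v s)"
        by (simp_all add: free_counit_eq_lin free_deriv_def fun_eq_iff)
      then have "(\<lambda>s. - v s) \<in> ?J"
        using v smult[of v "- 1"] smult[of "free_deriv v" "- 1"] by simp
      then show "inv\<^bsub>add_monoid (free_star_algebra n)\<^esub> v \<in> ?J"
        using v a_inv_free_star_algebra[OF closed, of v] unfolding a_inv_def by simp
    next
      show "\<one>\<^bsub>add_monoid (free_star_algebra n)\<^esub> \<in> ?J"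
      proof -
        have "free_deriv (\<lambda>s. 0) = (\<lambda>s. 0)"
          by (simp add: free_deriv_def lin_def fun_eq_iff)
        then show ?thesis
          by (simp add: zero free_counit_def)
      qed
    qed (use closed in auto)
  next
    fix v x assume v: "v \<in> ?J" and x: "x \<in> carrier (free_star_algebra n)"
    from v have vI: "v \<in> unitary_ideal n" "free_deriv v \<in> unitary_ideal n" and v0: "free_counit v = 0"
      by auto
    have fin: "finite {s. v s \<noteq> 0}" "finite {s. x s \<noteq> 0}"
      using free_star_algebra_finite[OF closed[OF vI(1)]] free_star_algebra_finite[OF x] .
    have "free_deriv (conv x v) = (\<lambda>t. conv (free_deriv x) v t + free_counit x * free_deriv v t)"
      using fin by (intro ext free_deriv_conv)
    also have "\<dots> \<in> unitary_ideal n"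
      by (intro add smult conv_l vI free_deriv_closed x)
    finally show "x \<otimes>\<^bsub>free_star_algebra n\<^esub> v \<in> ?J"
      using fin vI x v0 by (simp add: free_counit_conv conv_l)
    \<comment> \<open>Here \<epsilon>(v) = 0 removes the term \<epsilon>(v)D(x), whose factor D(x)
      need not lie in the ideal.\<close>
    have "free_deriv (conv v x) = conv (free_deriv v) x"
      using fin by (intro ext) (simp add: free_deriv_conv v0)
    then show "v \<otimes>\<^bsub>free_star_algebra n\<^esub> x \<in> ?J"
      using fin vI x v0 by (simp add: free_counit_conv conv_r)
  qed
  moreover have "unitary_rels n \<union> free_star ` unitary_rels n \<subseteq> ?J"
  proof
    fix r assume r: "r \<in> unitary_rels n \<union> free_star ` unitary_rels n"
    then have "r \<in> unitary_ideal n"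
      unfolding unitary_ideal_def
      using free_star_algebra.genideal_self[of "unitary_rels n \<union> free_star ` unitary_rels n" n]
        unitary_rels_star_subset all_rels_closed by blast
    moreover have "r \<in> all_rels n"
      using r unitary_rels_star_subset by blast
    ultimately show "r \<in> ?J"
      using rels_counit_deriv[of r n] smult[of r "- 1"] zero by auto
  qed
  ultimately have "unitary_ideal n \<subseteq> ?J"
    by (subst unitary_ideal_def) (rule free_star_algebra.genideal_minimal)
  with assms show "free_counit v = 0" "free_deriv v \<in> unitary_ideal n"
    by auto
qed

section \<open>Descent to the quotient algebra\<close>

definition pol_class :: "nat \<Rightarrow> free_elem \<Rightarrow> free_elem set" where
  "pol_class n v = unitary_ideal n +>\<^bsub>free_star_algebra n\<^esub> v"

definition deriv_U :: "nat \<Rightarrow> free_elem set \<Rightarrow> free_elem set" where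
  "deriv_U n = induced (free_star_algebra n) (unitary_ideal n) free_deriv"

lemma subgroup_unitary_ideal: "subgroup (unitary_ideal n) (add_monoid (free_star_algebra n))"
  using ideal_unitary_ideal by (simp add: ideal_def additive_subgroup_def)

lemma carrier_Pol_U: "carrier (Pol_U n) = pol_class n ` carrier (free_star_algebra n)"
  by (auto simp: Pol_U_def a_rcosets_eq pol_class_def)

lemma
  assumes "v \<in> carrier (free_star_algebra n)" "w \<in> carrier (free_star_algebra n)"
  shows Pol_U_add: "pol_class n v \<oplus>\<^bsub>Pol_U n\<^esub> pol_class n w = pol_class n (\<lambda>s. v s + w s)"
    and Pol_U_mult: "pol_class n v \<otimes>\<^bsub>Pol_U n\<^esub> pol_class n w = pol_class n (conv v w)"
  using free_star_algebra.coset_add[OF subgroup_unitary_ideal assms]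
    ideal.rcoset_mult_add[OF ideal_unitary_ideal assms]
  by (simp_all add: Pol_U_def pol_class_def)

lemma Pol_U_smult:
  assumes v: "v \<in> carrier (free_star_algebra n)"
  shows "c \<odot>\<^bsub>Pol_U n\<^esub> pol_class n v = pol_class n (\<lambda>s. c * v s)"
proof -
  interpret I: ideal "unitary_ideal n" "free_star_algebra n"
    by (rule ideal_unitary_ideal)
  have "(\<lambda>s. c * u s) \<in> unitary_ideal n" if "u \<in> unitary_ideal n" for u
    using I.I_l_closed[OF that smult_free_star_algebra(2)[OF free_star_algebra.one_closed], of c]
    by (simp add: smult_free_star_algebra(1)[OF I.a_Hcarr[OF that]])
  \<comment> \<open>The scalar action of \<open>quot_module\<close> is an instance of
    \<open>induced\<close>, so its value on a coset comes from \<open>induced_coset\<close>.\<close>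
  then have "induced (free_star_algebra n) (unitary_ideal n) (\<lambda>v s. c * v s) (pol_class n v) =
      pol_class n (\<lambda>s. c * v s)"
    unfolding pol_class_def
    by (intro induced_coset[OF abelian_group_free_star_algebra abelian_group_free_star_algebra
          subgroup_unitary_ideal subgroup_unitary_ideal] v)
      (auto simp: smult_free_star_algebra(2) distrib_left)
  then show ?thesis
    by (simp add: Pol_U_def induced_def pol_class_def)
qed

lemma deriv_U_class:
  assumes v: "v \<in> carrier (free_star_algebra n)"
  shows "deriv_U n (pol_class n v) = pol_class n (free_deriv v)"
  unfolding pol_class_def deriv_U_def
  by (intro induced_coset[OF abelian_group_free_star_algebra abelian_group_free_star_algebra
        subgroup_unitary_ideal subgroup_unitary_ideal] v)
    (auto simp: free_deriv_closed free_deriv_add[of _ n] unitary_ideal_counit_deriv)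

text \<open>Since \<open>free_counit\<close> vanishes on the ideal, its image of a coset is a
  singleton, and \<open>the_elem\<close> in the definition of \<open>counit\<close> has a determined
  value.\<close>

lemma counit_class:
  assumes v: "v \<in> carrier (free_star_algebra n)"
  shows "counit (pol_class n v) = free_counit v"
proof -
  interpret I: ideal "unitary_ideal n" "free_star_algebra n"
    by (rule ideal_unitary_ideal)
  have "free_counit u = free_counit v" if u: "u \<in> pol_class n v" for u
  proof -
    obtain h where h: "h \<in> unitary_ideal n" "u = (\<lambda>s. h s + v s)"
      using u by (auto simp: pol_class_def a_r_coset_def')
    then show ?thesis
      using free_counit_add[OF I.a_Hcarr[OF h(1)] v] unitary_ideal_counit_deriv(1)[OF h(1)]
      by simp
  qed
  moreover have "v \<in> pol_class n v"
    using free_star_algebra.a_rcosI[OF I.zero_closed I.a_subset v] v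
    by (simp add: pol_class_def)
  ultimately have "free_counit ` pol_class n v = {free_counit v}"
    by blast
  then show ?thesis by (simp add: counit_def)
qed

lemma counit_module_eq: "counit_module = character_module counit"
  by (simp add: counit_module_def character_module_def)

lemma scal_Pol_U: "scal (Pol_U n) c = pol_class n (\<lambda>s. c * single [] s)"
  using Pol_U_smult[OF free_star_algebra.one_closed, of n c]
  by (simp add: scal_def Pol_U_def pol_class_def)

lemma one_Pol_U: "\<one>\<^bsub>Pol_U n\<^esub> = pol_class n (single [])"
  by (simp add: Pol_U_def pol_class_def)

lemma complex_algebra_Pol_U:
  assumes "ring (Pol_U n)"
  shows "complex_algebra (Pol_U n)"
proof (intro complex_algebra.intro complex_algebra_axioms.intro assms)
  note scal = smult_free_star_algebra(2)[OF free_star_algebra.one_closed, simplified]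
  show "scal (Pol_U n) c \<in> carrier (Pol_U n)" for c
    using scal by (auto simp: carrier_Pol_U scal_Pol_U)
  show "scal (Pol_U n) (c + d) = scal (Pol_U n) c \<oplus>\<^bsub>Pol_U n\<^esub> scal (Pol_U n) d" for c d
    by (simp add: scal_Pol_U Pol_U_add scal distrib_right)
  show "scal (Pol_U n) (c * d) = scal (Pol_U n) c \<otimes>\<^bsub>Pol_U n\<^esub> scal (Pol_U n) d" for c d
    by (simp add: scal_Pol_U Pol_U_mult scal smult_free_star_algebra(1)[OF scal, symmetric] mult.assoc)
  show "scal (Pol_U n) 1 = \<one>\<^bsub>Pol_U n\<^esub>"
    by (simp add: scal_Pol_U one_Pol_U)
  fix x c assume "x \<in> carrier (Pol_U n)"
  then obtain v where v: "v \<in> carrier (free_star_algebra n)" "x = pol_class n v"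
    by (auto simp: carrier_Pol_U)
  \<comment> \<open>Right multiplication by a multiple of the empty word is again scaling, which
    makes the scalars central.\<close>
  have "conv v (\<lambda>s. c * single [] s) = (\<lambda>s. c * v s)"
  proof
    show "conv v (\<lambda>s. c * single [] s) s = c * v s" for s
      using conv_single_Nil(2)[OF free_star_algebra_finite[OF v(1)], THEN fun_cong, of s]
      by (simp add: conv_def mult.left_commute flip: sum_distrib_left)
  qed
  then show "scal (Pol_U n) c \<otimes>\<^bsub>Pol_U n\<^esub> x = x \<otimes>\<^bsub>Pol_U n\<^esub> scal (Pol_U n) c"
    using v by (simp add: scal_Pol_U Pol_U_mult scal smult_free_star_algebra(1)[OF v(1), symmetric])
qed

lemma character_derivation_Pol_U:
  assumes "ring (Pol_U n)" and "n \<ge> 1"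
  shows "character_derivation (Pol_U n) counit (deriv_U n)
    (pol_class n (\<lambda>s. single [Gen 1 1] s - single [] s))"
proof (intro character_derivation.intro character_derivation_axioms.intro complex_algebra_Pol_U assms(1))
  note scal = smult_free_star_algebra(2)[OF free_star_algebra.one_closed, simplified]
  note ops = Pol_U_add Pol_U_mult deriv_U_class counit_class
  have closed: "(\<lambda>s. v s + w s) \<in> carrier (free_star_algebra n)" "conv v w \<in> carrier (free_star_algebra n)"
    if "v \<in> carrier (free_star_algebra n)" "w \<in> carrier (free_star_algebra n)" for v w
    using free_star_algebra.a_closed[OF that] free_star_algebra.m_closed[OF that] by simp_all
  fix x assume "x \<in> carrier (Pol_U n)"
  then obtain v where v: "v \<in> carrier (free_star_algebra n)" and x: "x = pol_class n v"
    by (auto simp: carrier_Pol_U)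
  show "deriv_U n x \<in> carrier (Pol_U n)"
    using v by (auto simp: x ops carrier_Pol_U free_deriv_closed)
  fix y assume "y \<in> carrier (Pol_U n)"
  then obtain w where w: "w \<in> carrier (free_star_algebra n)" and y: "y = pol_class n w"
    by (auto simp: carrier_Pol_U)
  show "counit (x \<oplus>\<^bsub>Pol_U n\<^esub> y) = counit x + counit y"
    using v w by (simp add: x y ops closed free_counit_add)
  show "counit (x \<otimes>\<^bsub>Pol_U n\<^esub> y) = counit x * counit y"
    using v w by (simp add: x y ops closed free_counit_conv free_star_algebra_finite)
  show "deriv_U n (x \<oplus>\<^bsub>Pol_U n\<^esub> y) = deriv_U n x \<oplus>\<^bsub>Pol_U n\<^esub> deriv_U n y"
    using v w by (simp add: x y ops closed free_deriv_add free_deriv_closed)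
  \<comment> \<open>The scalar \<epsilon>(v) is rewritten as a multiple of the unit acting by
    multiplication, the form in which \<open>character_derivation\<close> states the product
    rule.\<close>
  have "free_deriv (conv v w) =
      (\<lambda>s. conv (free_deriv v) w s + conv (\<lambda>s. free_counit v * single [] s) (free_deriv w) s)"
    using v w smult_free_star_algebra(1)[OF free_deriv_closed[OF w], of "free_counit v"]
    by (simp add: free_deriv_conv free_star_algebra_finite fun_eq_iff)
  then show "deriv_U n (x \<otimes>\<^bsub>Pol_U n\<^esub> y) = deriv_U n x \<otimes>\<^bsub>Pol_U n\<^esub> y
      \<oplus>\<^bsub>Pol_U n\<^esub> scal (Pol_U n) (counit x) \<otimes>\<^bsub>Pol_U n\<^esub> deriv_U n y"
    using v w by (simp add: x y ops scal_Pol_U closed scal free_deriv_closed)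
next
  note scal = smult_free_star_algebra(2)[OF free_star_algebra.one_closed, simplified]
  show "counit (scal (Pol_U n) c) = c" for c
    by (simp add: scal_Pol_U counit_class scal free_counit_eq_lin lin_smult lin_single)
  let ?b = "\<lambda>s. single [Gen 1 1] s - single [] s"
  have u: "single [Gen 1 1] \<in> carrier (free_star_algebra n)"
    using assms(2) by (intro single_in_free_star_algebra) (simp add: letters_iff)
  have one: "single [] \<in> carrier (free_star_algebra n)"
    by (intro single_in_free_star_algebra) simp
  have b: "?b \<in> carrier (free_star_algebra n)"
    using free_star_algebra.minus_closed[OF u one] by (simp add: minus_free_star_algebra one)
  then show "pol_class n ?b \<in> carrier (Pol_U n)"
    by (simp add: carrier_Pol_U)
  have lin_b: "lin \<phi> ?b = \<phi> [Gen 1 1] - \<phi> []" for \<phi>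
    using lin_add[OF finite_support_single[of "[Gen 1 1]"], of "\<lambda>s. - 1 * single [] s" \<phi>]
      free_star_algebra_finite[OF scal, of "- 1"] lin_smult[of \<phi> "- 1" "single []"]
    by (simp add: lin_single)
  show "counit (pol_class n ?b) = 0"
    unfolding counit_class[OF b] free_counit_eq_lin lin_b by simp
  \<comment> \<open>D(u_11) = 1 and D(1) = 0, so the derivative of u_11 - 1 is the unit, with counit
    1.\<close>
  have "free_deriv ?b = single []"
    unfolding free_deriv_def lin_b by (simp add: fun_eq_iff)
  then show "counit (deriv_U n (pol_class n ?b)) \<noteq> 0"
    unfolding deriv_U_class[OF b] by (simp add: counit_class[OF one] free_counit_eq_lin lin_single)
qed

theorem corollaryB:
  fixes n :: nat
    and P :: "int \<Rightarrow> (free_elem set, 'p) module" and dP :: "int \<Rightarrow> 'p \<Rightarrow> 'p" and eP :: "'p \<Rightarrow> complex"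
    and Q :: "int \<Rightarrow> (free_elem set, 'q) module" and dQ :: "int \<Rightarrow> 'q \<Rightarrow> 'q" and eQ :: "'q \<Rightarrow> complex"
  assumes "n \<ge> 2"
    and "projective_resolution (Pol_U n) counit_module P dP eP"
    and "projective_resolution (opposite (Pol_U n)) counit_module Q dQ eQ"
    and "\<exists>\<iota> :: free_elem set \<Rightarrow> 'm. inj_on \<iota> (carrier (Pol_U n))"
  shows "\<not> (\<exists>\<phi> :: int \<Rightarrow> (free_elem set, 'm) module \<Rightarrow>
                  ('m \<times> 'p \<Rightarrow> complex) set set \<Rightarrow> ('q \<Rightarrow> 'm) set.
             poincare_duality_3 (Pol_U n) P dP Q dQ \<phi>)"
proof -
  obtain \<iota> :: "free_elem set \<Rightarrow> 'm" where \<iota>: "inj_on \<iota> (carrier (Pol_U n))"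
    using assms(4) by blast
  \<comment> \<open>A resolution comes with the statement that the resolved object is a module, and
    \<open>left_module\<close> contains the ring axioms for its scalars.\<close>
  have ring: "ring (Pol_U n)"
    using assms(2) by (auto simp: projective_resolution_def left_module_def)
  interpret regular_derivation "Pol_U n" "transported_regular (Pol_U n) \<iota>" "\<iota> \<one>\<^bsub>Pol_U n\<^esub>"
    "inv_into (carrier (Pol_U n)) \<iota>" counit "deriv_U n"
    "pol_class n (\<lambda>s. single [Gen 1 1] s - single [] s)"
    using assms(1)
    by (intro regular_derivation.intro character_derivation_Pol_U ring
        complex_algebra.rank_one_module_transported_regular[OF complex_algebra_Pol_U \<iota>]) auto
  show ?thesis
    using no_poincare_duality_3[OF assms(2) assms(3)[unfolded counit_module_eq]] by blast
qed

end
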